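(* Assume $\mathfrak{p}=\mathfrak{c}$. Then there is a p-point $\mathcal{U}$ on $\omega$ such that $\mathcal{U}\not\ge_T\omega^\omega$, and therefore $\mathcal{U}<_T\mathcal{U}\cdot\mathcal{U}<_T([\mathfrak{c}]^{<\omega},\subseteq)$.
   Context: $\mathfrak{p}$ is the pseudo-intersection number and $\mathfrak{c}=2^{\aleph_0}$. Ultrafilters are ordered by $\supseteq$, $\omega^\omega$ by pointwise $\le$, and $[\mathfrak{c}]^{<\omega}$ (finite subsets of $\mathfrak{c}$) by inclusion. $D\le_T E$ means there is a map $E\to D$ sending cofinal subsets to cofinal subsets; $D<_T E$ means $D\le_T E$ and $E\not\le_T D$. $\mathcal{U}\cdot\mathcal{U}=\{A\subseteq\omega\times\omega:\{i:\{j:(i,j)\in A\}\in\mathcal{U}\}\in\mathcal{U}\}$. A p-point is a nonprincipal ultrafilter on $\omega$ in which every countable subfamily $\{X_n\}$ has some $X$ in the ultrafilter with $X\setminus X_n$ finite for all $n$. *)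

theory Defs
  imports Main "HOL-Library.Infinite_Set"
begin

unbundle cardinal_syntax

text \<open>A preordered set is given by its (reflexive) order relation; its underlying set is the
  \<^const>\<open>Field\<close>. Note that \<^const>\<open>BNF_Cardinal_Order_Relation.cofinal\<close> from the library demands
  strictly larger elements and is therefore not the notion of cofinality used here.\<close>

definition cofinal_subset :: "'a rel \<Rightarrow> 'a set \<Rightarrow> bool" where
  "cofinal_subset R X \<longleftrightarrow> X \<subseteq> Field R \<and> (\<forall>a\<in>Field R. \<exists>x\<in>X. (a, x) \<in> R)"

definition tukey_le :: "'a rel \<Rightarrow> 'b rel \<Rightarrow> bool" (infix \<open>\<le>\<^sub>T\<close> 50) where
  "D \<le>\<^sub>T E \<longleftrightarrow> (\<exists>f. f ` Field E \<subseteq> Field D \<and>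
     (\<forall>X. cofinal_subset E X \<longrightarrow> cofinal_subset D (f ` X)))"

definition tukey_less :: "'a rel \<Rightarrow> 'b rel \<Rightarrow> bool" (infix \<open><\<^sub>T\<close> 50) where
  "D <\<^sub>T E \<longleftrightarrow> D \<le>\<^sub>T E \<and> \<not> E \<le>\<^sub>T D"

definition ultrafilter :: "'a set set \<Rightarrow> bool" where
  "ultrafilter U \<longleftrightarrow> UNIV \<in> U \<and> {} \<notin> U \<and>
     (\<forall>A\<in>U. \<forall>B. A \<subseteq> B \<longrightarrow> B \<in> U) \<and> (\<forall>A\<in>U. \<forall>B\<in>U. A \<inter> B \<in> U) \<and>
     (\<forall>A. A \<in> U \<or> - A \<in> U)"

definition principal :: "'a set set \<Rightarrow> bool" where
  "principal U \<longleftrightarrow> (\<exists>a. U = {A. a \<in> A})"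

definition p_point :: "nat set set \<Rightarrow> bool" where
  "p_point U \<longleftrightarrow> ultrafilter U \<and> \<not> principal U \<and>
     (\<forall>X :: nat \<Rightarrow> nat set. (\<forall>n. X n \<in> U) \<longrightarrow> (\<exists>Y\<in>U. \<forall>n. finite (Y - X n)))"

definition fubini_square :: "'a set set \<Rightarrow> ('a \<times> 'a) set set" where
  "fubini_square U = {A. {i. {j. (i, j) \<in> A} \<in> U} \<in> U}"

definition reverse_inclusion :: "'a set set \<Rightarrow> 'a set rel" where
  "reverse_inclusion U = relation_of (\<supseteq>) U"

definition baire_order :: "(nat \<Rightarrow> nat) rel" where
  "baire_order = relation_of (\<le>) UNIV"

text \<open>\<^term>\<open>ctwo ^c natLeq\<close> is the library's $2^{\aleph_0}$. A cardinal is represented by a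
  well-order, whose field plays the role of the corresponding von Neumann cardinal.\<close>

definition continuum :: "(nat \<Rightarrow> bool) rel" where
  "continuum = ctwo ^c natLeq"

lemma Field_relation_of: "(\<And>a. a \<in> A \<Longrightarrow> P a a) \<Longrightarrow> Field (relation_of P A) = A"
  by (auto simp: relation_of_def Field_def)

definition finite_subsets_order :: "'a rel \<Rightarrow> 'a set rel" where
  "finite_subsets_order r = relation_of (\<subseteq>) (Fpow (Field r))"

lemma Field_directed_sets:
  "Field (reverse_inclusion U) = U"
  "Field baire_order = UNIV"
  "Field (finite_subsets_order r) = Fpow (Field r)"
  by (simp_all add: reverse_inclusion_def baire_order_def finite_subsets_order_def
      Field_relation_of)

lemma Field_continuum: "Field continuum = UNIV"
  by (simp add: continuum_def cexp_def ctwo_def Field_natLeq Func_def Field_card_of)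

definition strong_fip :: "nat set set \<Rightarrow> bool" where
  "strong_fip F \<longleftrightarrow> (\<forall>G. G \<subseteq> F \<and> finite G \<longrightarrow> infinite (\<Inter>G))"

definition pseudo_intersection :: "nat set \<Rightarrow> nat set set \<Rightarrow> bool" where
  "pseudo_intersection P F \<longleftrightarrow> infinite P \<and> (\<forall>A\<in>F. finite (P - A))"

definition pseudo_gap :: "nat set set \<Rightarrow> bool" where
  "pseudo_gap F \<longleftrightarrow> strong_fip F \<and> \<not> (\<exists>P. pseudo_intersection P F)"

text \<open>The least cardinality of a \<^const>\<open>pseudo_gap\<close> family; the choice of the witness is immaterial up
  to \<^const>\<open>ordIso\<close>, and the lemma \<open>pseudo_intersection_number_least\<close> below shows that a
  witness exists.\<close>

definition pseudo_intersection_number :: "nat set rel" where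
  "pseudo_intersection_number =
     |SOME F. pseudo_gap F \<and> (\<forall>G. pseudo_gap G \<longrightarrow> |F| \<le>o |G| )|"

lemma pseudo_gap_exists: "\<exists>F. pseudo_gap F"
proof -
  have chain: "\<exists>U\<in>{F. strong_fip F}. \<forall>X\<in>C. X \<subseteq> U"
    if C: "subset.chain {F. strong_fip F} C" for C
  proof (cases "C = {}")
    case True
    have "strong_fip {}" by (simp add: strong_fip_def)
    then show ?thesis using True by blast
  next
    case False
    have "infinite (\<Inter>G)" if G: "G \<subseteq> \<Union>C" "finite G" for G
    proof -
      obtain X where X: "X \<in> C" "G \<subseteq> X"
        using finite_subset_Union_chain[OF G(2,1) False] C by blast
      then have "strong_fip X" using C by (auto simp: subset.chain_def)
      then show ?thesis using X G by (auto simp: strong_fip_def)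
    qed
    then have "strong_fip (\<Union>C)" by (simp add: strong_fip_def)
    then show ?thesis by blast
  qed
  obtain M where M: "strong_fip M" "\<And>X. strong_fip X \<Longrightarrow> M \<subseteq> X \<Longrightarrow> X = M"
    using subset_Zorn[OF chain] by auto
  have "\<not> pseudo_intersection P M" for P
  proof
    assume P: "pseudo_intersection P M"
    obtain Q R where "Q \<subseteq> P" "R \<subseteq> P" "infinite Q" "infinite R" "Q \<inter> R = {}"
      using infinite_split[of P] P by (auto simp: pseudo_intersection_def)
    moreover from this have "R \<subseteq> P - Q" by blast
    ultimately have Q: "Q \<subseteq> P" "infinite Q" "infinite (P - Q)"
      using infinite_super by blast+
    have "infinite (\<Inter>G)" if G: "G \<subseteq> insert Q M" "finite G" for G
    proof
      assume fin: "finite (\<Inter>G)"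
      have "finite (Q - A)" if "A \<in> G" for A
      proof (cases "A = Q")
        case False
        then have "finite (P - A)" using that G P by (auto simp: pseudo_intersection_def)
        then show ?thesis using Q(1) by (meson Diff_mono finite_subset order_refl)
      qed simp
      then have "finite (\<Union>A\<in>G. Q - A)" using G(2) by blast
      moreover have "Q \<subseteq> \<Inter>G \<union> (\<Union>A\<in>G. Q - A)" by blast
      ultimately show False using fin Q(2) by (meson finite_UnI finite_subset)
    qed
    then have "strong_fip (insert Q M)" by (simp add: strong_fip_def)
    then have "Q \<in> M" using M(2) by blast
    then show False using P Q(3) by (auto simp: pseudo_intersection_def)
  qed
  then show ?thesis using M(1) by (auto simp: pseudo_gap_def)
qed

lemma pseudo_intersection_number_least:
  obtains F where "pseudo_gap F" "pseudo_intersection_number = |F|"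
    "\<And>G. pseudo_gap G \<Longrightarrow> pseudo_intersection_number \<le>o |G|"
proof -
  have "\<exists>r\<in>card_of ` {F. pseudo_gap F}. \<forall>r'\<in>card_of ` {F. pseudo_gap F}. r \<le>o r'"
    by (rule exists_minim_Card_order) (use pseudo_gap_exists card_of_Card_order in auto)
  then have "\<exists>F. pseudo_gap F \<and> (\<forall>G. pseudo_gap G \<longrightarrow> |F| \<le>o |G| )" by auto
  from someI_ex[OF this] show ?thesis
    by (intro that[OF _ pseudo_intersection_number_def])
      (auto simp: pseudo_intersection_number_def)
qed

end

theory Submission
  imports Defs "HOL-Library.Countable_Set" "HOL-Library.Diagonal_Subsequence"
begin

text \<open>The ultrafilter \<open>U\<close> is the dual of an ideal generated by compact hereditary families of sets of
  naturals, added in \<open>\<cc>\<close> many steps such that \<open>\<nat>\<close> is never a finite union of members of these families.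
  Adding \<open>Pow (- A)\<close> puts \<open>A\<close> into \<open>U\<close>. At each stage fewer than \<open>\<pp>\<close> families are present, and by
  compactness a set lies outside the ideal as soon as it contains, for each finite list of families, one finite
  set that is not covered by them; so \<open>\<pp> = \<cc>\<close> yields pseudo-intersections outside the ideal, which makes
  \<open>U\<close> a p-point.

  For a p-point, a Tukey map \<open>g\<close> from \<open>\<omega>\<^sup>\<omega>\<close> to \<open>U\<close> is controlled by its countable trace
  \<open>f(t)(n) = sup {h(n) | t \<subseteq> g(h)}\<close> on finite sets \<open>t\<close>: for all \<open>A \<in> U\<close> and \<open>n\<close> one has
  \<open>f(t)(n) < \<infinity>\<close> for some finite \<open>t \<subseteq> A\<close>, while \<open>f(t) \<ge> h\<close> for all finite \<open>t \<subseteq> g(h)\<close>. Each possible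
  trace is destroyed at some stage. Either a set \<open>P\<close> with \<open>f(t)(n) = \<infinity>\<close> for all finite \<open>t \<subseteq> P\<close> can be
  put into \<open>U\<close>. Or, again by compactness, for each finite list of present families the functions \<open>h\<close> such
  that this list together with finitely many copies of \<open>K(h) = {A. f(t) \<ge> h for all finite t \<subseteq> A}\<close>
  covers \<open>\<nat>\<close> form a bounded set; since \<open>\<pp> \<le> \<dd>\<close>, some \<open>K(h)\<close> can be added, which keeps \<open>g(h)\<close> out of
  \<open>U\<close>.

  Finally \<open>U \<cdot> U\<close> is above both \<open>U\<close> and \<open>\<omega>\<^sup>\<omega>\<close>, hence not below \<open>U\<close>. It is not above the finite
  subsets of \<open>\<cc>\<close>, because an uncountable family in \<open>U \<cdot> U\<close> contains a sequence whose slices all converge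
  to slices of a member and, \<open>U\<close> being a p-point, a subsequence of it is bounded.\<close>

section \<open>Cardinalities\<close>

lemma continuum_ordIso: "continuum =o |UNIV :: (nat \<Rightarrow> bool) set|"
  using card_of_Field_ordIso[of continuum] Field_continuum ordIso_symmetric
  by (metis Card_order_cexp continuum_def)

lemma Card_order_continuum: "Card_order continuum"
  by (simp add: continuum_def Card_order_cexp)

lemma natLeq_ordLess_continuum: "natLeq <o continuum"
  by (simp add: continuum_def ordLess_ctwo_cexp natLeq_Card_order)

lemma infinite_Field_continuum: "infinite (Field continuum)"
proof -
  have "natLeq \<le>o |Field continuum|"
    using natLeq_ordLess_continuum card_of_Field_ordIso[OF Card_order_continuum]
      ordIso_symmetric ordLess_imp_ordLeq ordLeq_ordIso_trans by blast
  then show ?thesis using infinite_iff_natLeq_ordLeq by blast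
qed

lemma countable_ordLeq_natLeq: "countable A \<Longrightarrow> |A| \<le>o natLeq"
  using card_of_ordLeqI[of _ A "UNIV :: nat set"] card_of_nat ordLeq_ordIso_trans
  unfolding countable_def by blast

lemma countable_ordLess_continuum: "countable A \<Longrightarrow> |A| <o continuum"
  using countable_ordLeq_natLeq natLeq_ordLess_continuum ordLeq_ordLess_trans by blast

lemma ordLeq_continuumI: "inj_on f A \<Longrightarrow> |A| \<le>o continuum" for f :: "'a \<Rightarrow> nat \<Rightarrow> bool"
  using card_of_ordLeqI[of f A UNIV] continuum_ordIso ordIso_symmetric ordLeq_ordIso_trans by blast

lemma card_of_sets_ordLeq_continuum: "|A :: 'a :: countable set set| \<le>o continuum"
proof (rule ordLeq_continuumI)
  show "inj_on (\<lambda>A n. n \<in> (to_nat :: 'a \<Rightarrow> nat) ` A) A"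
    by (rule inj_onI) (metis inj_image_eq_iff inj_to_nat set_eqI)
qed

lemma card_of_Un_ordLess_continuum:
  "|A| <o continuum \<Longrightarrow> |B| <o continuum \<Longrightarrow> |A \<union> B| <o continuum"
  by (rule card_of_Un_ordLess_infinite_Field[OF infinite_Field_continuum Card_order_continuum])

lemma card_of_image_ordLess: "|A| <o r \<Longrightarrow> |f ` A| <o r"
  using card_of_image ordLeq_ordLess_trans by blast

lemma card_of_lists_ordLeq:
  assumes "infinite B" "|A| \<le>o |B|"
  shows "|lists A| \<le>o |B|"
proof -
  have "|{xs \<in> lists A. length xs = n}| \<le>o |B|" for n
  proof (induction n)
    case 0
    have "finite {xs \<in> lists A. length xs = 0}" by (rule finite_subset[of _ "{[]}"]) auto
    then show ?case using assms(1) card_of_ordLeq_infinite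
      by (meson card_of_Well_order ordLeq_total)
  next
    case (Suc n)
    have "{xs \<in> lists A. length xs = Suc n}
        \<subseteq> (\<lambda>(x, xs). x # xs) ` (A \<times> {xs \<in> lists A. length xs = n})"
      by (force simp: length_Suc_conv)
    then have "|{xs \<in> lists A. length xs = Suc n}| \<le>o |A \<times> {xs \<in> lists A. length xs = n}|"
      by (rule surj_imp_ordLeq)
    also have "|A \<times> {xs \<in> lists A. length xs = n}| \<le>o |B|"
      using assms Suc by (intro card_of_Times_ordLeq_infinite_Field) (simp_all add: Field_card_of card_of_card_order_on)
    finally show ?case .
  qed
  then have "|\<Union>n\<in>UNIV. {xs \<in> lists A. length xs = n}| \<le>o |B|"
    by (intro card_of_UNION_ordLeq_infinite[OF assms(1)])
      (use assms infinite_iff_card_of_nat in auto)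
  moreover have "(\<Union>n\<in>UNIV. {xs \<in> lists A. length xs = n}) = lists A" by auto
  ultimately show ?thesis by simp
qed

text \<open>Since \<open>A\<close> may be finite, a disjoint copy of the naturals is added before
  infinite cardinal arithmetic is applied.\<close>

lemma card_of_lists_Times_ordLess_continuum:
  assumes "|A| <o continuum"
  shows "|lists A \<times> (UNIV :: nat set)| <o continuum"
proof -
  let ?B = "A <+> (UNIV :: nat set)"
  have A: "|A| \<le>o |?B|" and N: "|UNIV :: nat set| \<le>o |?B|"
    by (rule card_of_Plus1 card_of_Plus2)+
  have B: "infinite ?B" by simp
  have "|lists A \<times> (UNIV :: nat set)| \<le>o |?B|"
    by (intro card_of_Times_ordLeq_infinite_Field card_of_lists_ordLeq[OF B A] N card_of_Card_order)
      (use B in \<open>simp only: Field_card_of not_False_eq_True\<close>)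
  also have "|?B| <o continuum"
    by (rule card_of_Plus_ordLess_infinite_Field[OF infinite_Field_continuum Card_order_continuum])
      (use assms countable_ordLess_continuum[of "UNIV :: nat set"] in auto)
  finally show ?thesis .
qed

section \<open>Consequences of \<open>\<pp> = \<cc>\<close>\<close>

text \<open>A bijection carries the definition from sets of naturals to any countably infinite type;
  pairs and lists of naturals are the cases of interest.\<close>

lemma pseudo_intersection_exists:
  fixes F :: "'a :: countable set set"
  assumes pc: "pseudo_intersection_number =o continuum" and "infinite (UNIV :: 'a set)"
    and F: "|F| <o continuum" and fip: "\<And>G. G \<subseteq> F \<Longrightarrow> finite G \<Longrightarrow> infinite (\<Inter>G)"
  obtains P where "infinite P" "\<And>A. A \<in> F \<Longrightarrow> finite (P - A)"
proof -
  obtain e :: "'a \<Rightarrow> nat" where e: "bij e"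
    using countableE_infinite[of "UNIV :: 'a set"] assms(2) by auto
  let ?F = "(`) e ` F"
  have "|?F| <o pseudo_intersection_number"
    using card_of_image_ordLess[OF F] pc ordIso_symmetric ordLess_ordIso_trans by blast
  then have "\<not> pseudo_gap ?F"
    using pseudo_intersection_number_least not_ordLess_ordLeq by metis
  moreover have "strong_fip ?F"
    unfolding strong_fip_def
  proof (intro allI impI)
    fix G assume "G \<subseteq> ?F \<and> finite G"
    then obtain G' where G': "G' \<subseteq> F" "finite G'" "G = (`) e ` G'"
      by (meson finite_subset_image)
    show "infinite (\<Inter>G)"
    proof (cases "G' = {}")
      case True then show ?thesis using G' by simp
    next
      case False
      then have "\<Inter>G = e ` \<Inter>G'"
        using image_INT[of e UNIV G' "\<lambda>x. x"] G'(3) e by (auto simp: bij_def)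
      then show ?thesis
        using fip[OF G'(1,2)]
        by (simp add: finite_image_iff[OF inj_on_subset[OF bij_is_inj[OF e] subset_UNIV]])
    qed
  qed
  ultimately obtain P where P: "infinite P" "\<And>A. A \<in> F \<Longrightarrow> finite (P - e ` A)"
    by (auto simp: pseudo_gap_def pseudo_intersection_def)
  show ?thesis
  proof
    show "infinite (e -` P)" using P(1) e
      by (metis bij_def finite_imageI image_vimage_eq inf_top.right_neutral)
    show "finite (e -` P - A)" if "A \<in> F" for A
    proof -
      have "e -` P - A = e -` (P - e ` A)" using e by (auto simp: bij_def inj_image_mem_iff)
      then show ?thesis using P(2)[OF that] e by (simp add: bij_def finite_vimageI)
    qed
  qed
qed

text \<open>This is the inequality \<open>\<pp> \<le> \<dd>\<close>.\<close>

lemma not_dominated: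
  fixes E :: "(nat \<Rightarrow> nat) set"
  assumes pc: "pseudo_intersection_number =o continuum" and E: "|E| <o continuum"
  obtains h where "\<And>e. e \<in> E \<Longrightarrow> \<not> h \<le> e"
proof -
  \<comment> \<open>A pseudo-intersection has finite columns because of the half-planes and meets
    the region above every graph; its column maxima form \<open>h\<close>.\<close>
  define F where "F = (\<lambda>e. {(n, k). e n < k}) ` E \<union> range (\<lambda>N. {(n :: nat, k :: nat). N \<le> n})"
  have "|F| <o continuum"
    unfolding F_def
    by (intro card_of_Un_ordLess_continuum card_of_image_ordLess[OF E])
      (simp add: countable_ordLess_continuum)
  moreover have "infinite (\<Inter>G)" if G: "G \<subseteq> F" "finite G" for G
  proof -
    \<comment> \<open>Invariant of finite intersections: almost every column is contained in the set
      up to finitely many points.\<close>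
    have "\<exists>n0. \<forall>n\<ge>n0. \<exists>k0. \<forall>k\<ge>k0. (n, k) \<in> \<Inter>G"
      using G(2,1)
    proof (induction G)
      case (insert A G)
      then obtain n0 where n0: "\<And>n. n \<ge> n0 \<Longrightarrow> \<exists>k0. \<forall>k\<ge>k0. (n, k) \<in> \<Inter>G" by auto
      have "\<exists>n1. \<forall>n\<ge>n1. \<exists>k0. \<forall>k\<ge>k0. (n, k) \<in> A"
      proof -
        from insert.prems consider e where "A = {(n, k). e n < k}" | N where "A = {(n, k). N \<le> n}"
          unfolding F_def by blast
        then show ?thesis
        proof cases
          case (1 e)
          then have "\<forall>n. \<forall>k\<ge>Suc (e n). (n, k) \<in> A" by auto
          then show ?thesis by blast
        qed auto
      qed
      then obtain n1 where n1: "\<And>n. n \<ge> n1 \<Longrightarrow> \<exists>k0. \<forall>k\<ge>k0. (n, k) \<in> A" by blast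
      have "\<exists>k0. \<forall>k\<ge>k0. (n, k) \<in> \<Inter>(insert A G)" if "n \<ge> max n0 n1" for n
      proof -
        have "n \<ge> n0" "n \<ge> n1" using that by auto
        then obtain k0 k1 where "\<forall>k\<ge>k0. (n, k) \<in> \<Inter>G" "\<forall>k\<ge>k1. (n, k) \<in> A"
          using n0 n1 by blast
        then have "\<forall>k\<ge>max k0 k1. (n, k) \<in> \<Inter>(insert A G)" by simp
        then show ?thesis by blast
      qed
      then show ?case by blast
    qed auto
    then obtain n k0 where k0: "\<And>k. k \<ge> k0 \<Longrightarrow> (n, k) \<in> \<Inter>G" by blast
    then have "Pair n ` {k0..} \<subseteq> \<Inter>G" by auto
    moreover have "infinite (Pair n ` {k0..})"
      by (simp add: finite_image_iff inj_on_def infinite_Ici)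
    ultimately show ?thesis using infinite_super by blast
  qed
  ultimately obtain P where P: "infinite P" "\<And>A. A \<in> F \<Longrightarrow> finite (P - A)"
    using pseudo_intersection_exists[OF pc, of F]
    by (auto simp: finite_prod)
  have col: "finite {k. (n, k) \<in> P}" for n
  proof -
    have "finite (P - {(m, k). Suc n \<le> m})" by (rule P(2)) (auto simp: F_def)
    moreover have "Pair n ` {k. (n, k) \<in> P} \<subseteq> P - {(m, k). Suc n \<le> m}" by auto
    ultimately have "finite (Pair n ` {k. (n, k) \<in> P})" using finite_subset by blast
    then show ?thesis by (simp add: finite_image_iff inj_on_def)
  qed
  show ?thesis
  proof
    fix e assume "e \<in> E"
    then have "finite (P - {(n, k). e n < k})" by (intro P(2)) (auto simp: F_def)
    then have "\<not> P \<subseteq> P - {(n, k). e n < k}"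
      using P(1) finite_subset by blast
    then obtain n k where nk: "(n, k) \<in> P" "e n < k" by blast
    \<comment> \<open>This column is nonempty, so the unspecified \<open>Max\<close> of empty
      columns does not matter.\<close>
    then have "e n < Max {k. (n, k) \<in> P}"
      using Max_ge[OF col, of k n] by simp
    then show "\<not> (\<lambda>n. Max {k. (n, k) \<in> P}) \<le> e"
      by (meson le_funD not_le)
  qed
qed

section \<open>Compact hereditary families\<close>

definition converges :: "(nat \<Rightarrow> nat set) \<Rightarrow> nat set \<Rightarrow> bool" where
  "converges A B \<longleftrightarrow> (\<forall>n. \<forall>\<^sub>F i in sequentially. n \<in> A i \<longleftrightarrow> n \<in> B)"

lemma converges_subset:
  assumes "converges A B" "finite t" "t \<subseteq> B"
  shows "\<forall>\<^sub>F i in sequentially. t \<subseteq> A i"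
proof -
  have "\<forall>x\<in>t. \<forall>\<^sub>F i in sequentially. x \<in> A i"
  proof
    fix x assume "x \<in> t"
    then have "x \<in> B" using assms(3) by blast
    then show "\<forall>\<^sub>F i in sequentially. x \<in> A i"
      using assms(1) unfolding converges_def by (metis (mono_tags, lifting) eventually_mono)
  qed
  from eventually_ball_finite[OF assms(2) this] show ?thesis
    by (rule eventually_mono) blast
qed

lemma converges_compose:
  "converges A B \<Longrightarrow> strict_mono r \<Longrightarrow> converges (A \<circ> r) B"
  unfolding converges_def comp_def using eventually_subseq[where P = "\<lambda>i. (n \<in> A i) = (n \<in> B)" for n]
  by blast

lemma constant_subseq:
  fixes p :: "nat \<Rightarrow> bool"
  shows "\<exists>r :: nat \<Rightarrow> nat. strict_mono r \<and> (\<exists>b. \<forall>i. p (r i) = b)"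
proof -
  have "infinite {i. p i} \<or> infinite {i. \<not> p i}"
    using finite_Collect_not infinite_UNIV_nat by blast
  then have "infinite {i. p i = True} \<or> infinite {i. p i = False}" by simp
  then obtain b where "infinite {i. p i = b}" by blast
  from strict_mono_enumerate[OF this] enumerate_in_set[OF this] show ?thesis by blast
qed

text \<open>Sequential compactness of the Cantor space: membership of each \<open>n\<close> is made
  constant in turn, and on the diagonal sequence it is constant from index \<open>Suc n\<close>
  on.\<close>

lemma convergent_subseq:
  fixes A :: "nat \<Rightarrow> nat set"
  obtains r B where "strict_mono r" "converges (A \<circ> r) B"
proof -
  interpret subseqs "\<lambda>n s. \<exists>b. \<forall>i. (n \<in> A (s i)) = b"
    by unfold_locales (use constant_subseq in \<open>auto simp: o_def\<close>)
  have "\<exists>b. \<forall>i. (n \<in> A ((diagseq \<circ> ((+) (Suc n))) i)) = b" for n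
    by (rule diagseq_holds) auto
  then have "\<forall>n. \<exists>b. \<forall>i. (n \<in> A (diagseq (Suc n + i))) = b" by (simp add: o_def)
  then obtain b where b: "\<And>n i. (n \<in> A (diagseq (Suc n + i))) = b n"
    unfolding choice_iff by blast
  have "converges (A \<circ> diagseq) {n. b n}"
    unfolding converges_def eventually_sequentially
  proof (intro allI exI impI)
    fix n i assume "Suc n \<le> i"
    then show "n \<in> (A \<circ> diagseq) i \<longleftrightarrow> n \<in> {n. b n}"
      using b[of n "i - Suc n"] by simp
  qed
  then show ?thesis using that subseq_diagseq by blast
qed

text \<open>Among the families containing the empty set these are exactly those that are closed under
  subsets and closed in the Cantor space of all sets of naturals.\<close>

definition compact_family :: "nat set set \<Rightarrow> bool" where
  "compact_family K \<longleftrightarrow> {} \<in> K \<and> (\<forall>A\<in>K. \<forall>B\<subseteq>A. B \<in> K) \<and>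
     (\<forall>A. (\<forall>t. finite t \<and> t \<subseteq> A \<longrightarrow> t \<in> K) \<longrightarrow> A \<in> K)"

lemma compact_family_empty: "compact_family K \<Longrightarrow> {} \<in> K"
  and compact_family_subset: "compact_family K \<Longrightarrow> A \<in> K \<Longrightarrow> B \<subseteq> A \<Longrightarrow> B \<in> K"
  and compact_family_closed: "compact_family K \<Longrightarrow> (\<And>t. finite t \<Longrightarrow> t \<subseteq> A \<Longrightarrow> t \<in> K) \<Longrightarrow> A \<in> K"
  unfolding compact_family_def by blast+

lemma compact_family_Pow: "compact_family (Pow A)"
proof -
  have "B \<subseteq> A" if "\<forall>t. finite t \<and> t \<subseteq> B \<longrightarrow> t \<subseteq> A" for B
  proof
    fix x assume "x \<in> B"
    then show "x \<in> A" using that[rule_format, of "{x}"] by simp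
  qed
  then show ?thesis unfolding compact_family_def by auto
qed

text \<open>A finite \<open>t \<subseteq> B\<close> is contained in \<open>A (r i)\<close> for all
  large \<open>i\<close>, and \<open>r i \<ge> j\<close> puts \<open>A (r i)\<close> into
  \<open>K j\<close>.\<close>

lemma compact_family_limit:
  assumes "\<And>j. compact_family (K j)" "decseq K" "strict_mono r" "converges (A \<circ> r) B"
    and "\<And>i. A i \<in> K i"
  shows "B \<in> (\<Inter>j. K j)"
proof
  fix j
  show "B \<in> K j"
  proof (rule compact_family_closed[OF assms(1)])
    fix t assume "finite t" "t \<subseteq> B"
    from converges_subset[OF assms(4) this] obtain N where N: "\<And>i. i \<ge> N \<Longrightarrow> t \<subseteq> A (r i)"
      unfolding eventually_sequentially by auto
    let ?i = "max N j"
    have "j \<le> r ?i" using seq_suble[OF assms(3), of ?i] by linarith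
    then have "A (r ?i) \<in> K j" 
      using decseqD[OF assms(2)] assms(5)[of "r ?i"] by blast
    then show "t \<in> K j" using N[of ?i] compact_family_subset[OF assms(1)] by simp
  qed
qed

section \<open>Unions of members of compact families\<close>

definition joins :: "nat set set \<Rightarrow> nat set set \<Rightarrow> nat set set" where
  "joins K M = {A \<union> B |A B. A \<in> K \<and> B \<in> M}"

lemma joinsI: "A \<in> K \<Longrightarrow> B \<in> M \<Longrightarrow> C = A \<union> B \<Longrightarrow> C \<in> joins K M"
  unfolding joins_def by blast

lemma joins_mono: "K \<subseteq> K' \<Longrightarrow> M \<subseteq> M' \<Longrightarrow> joins K M \<subseteq> joins K' M'"
  unfolding joins_def by blast

text \<open>Along a common subsequence both halves of \<open>A = B j \<union> C j\<close> converge.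
  Each point is eventually decided in both halves, so the limits still have union
  \<open>A\<close>.\<close>

lemma joins_limit:
  assumes K: "\<And>j. compact_family (K j)" "decseq K" and M: "\<And>j. compact_family (M j)" "decseq M"
    and A: "\<And>j. A \<in> joins (K j) (M j)"
  shows "A \<in> joins (\<Inter>j. K j) (\<Inter>j. M j)"
proof -
  obtain B C where BC: "\<And>j. B j \<in> K j" "\<And>j. C j \<in> M j" "\<And>j. A = B j \<union> C j"
    using A unfolding joins_def by simp metis
  obtain r B' where r: "strict_mono r" "converges (B \<circ> r) B'" by (rule convergent_subseq)
  obtain s C' where s: "strict_mono s" "converges ((C \<circ> r) \<circ> s) C'" by (rule convergent_subseq)
  have rs: "strict_mono (r \<circ> s)" using r s by (simp add: strict_mono_o)
  have B': "converges (B \<circ> (r \<circ> s)) B'" and C': "converges (C \<circ> (r \<circ> s)) C'"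
    using converges_compose[OF r(2) s(1)] s(2) by (simp_all add: comp_assoc)
  have "x \<in> A \<longleftrightarrow> x \<in> B' \<union> C'" for x
  proof -
    have "\<forall>\<^sub>F i in sequentially. (x \<in> (B \<circ> (r \<circ> s)) i \<longleftrightarrow> x \<in> B') \<and> (x \<in> (C \<circ> (r \<circ> s)) i \<longleftrightarrow> x \<in> C')"
      using B' C' unfolding converges_def by (intro eventually_conj) auto
    then obtain i where "x \<in> (B \<circ> (r \<circ> s)) i \<longleftrightarrow> x \<in> B'" "x \<in> (C \<circ> (r \<circ> s)) i \<longleftrightarrow> x \<in> C'"
      using eventually_happens by fastforce
    then show ?thesis using BC(3)[of "r (s i)"] by auto
  qed
  then have "A = B' \<union> C'" by blast
  moreover have "B' \<in> (\<Inter>j. K j)" by (rule compact_family_limit[OF K rs B' BC(1)])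
  moreover have "C' \<in> (\<Inter>j. M j)" by (rule compact_family_limit[OF M rs C' BC(2)])
  ultimately show ?thesis unfolding joins_def by blast
qed

text \<open>For closedness, \<open>K\<close> is approximated by the decreasing families
  \<open>tr K j\<close>, which test only the part of a set below \<open>j\<close>. A splitting of
  \<open>A \<inter> {..<j}\<close> becomes one of \<open>A\<close> when the rest of \<open>A\<close>
  is added to both halves, and \<open>joins_limit\<close> lets \<open>j\<close> grow.\<close>

lemma compact_family_joins:
  assumes K: "compact_family K" and M: "compact_family M"
  shows "compact_family (joins K M)"
proof -
  define tr where "tr = (\<lambda>K (j :: nat). {A. A \<inter> {..<j} \<in> K})"
  have tr: "compact_family (tr K j)" "decseq (tr K)" "(\<Inter>j. tr K j) = K" if K: "compact_family K" for K j
  proof -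
    show "compact_family (tr K j)"
      unfolding compact_family_def
    proof (intro conjI ballI allI impI)
      show "{} \<in> tr K j" using compact_family_empty[OF K] by (simp add: tr_def)
      show "B \<in> tr K j" if "A \<in> tr K j" "B \<subseteq> A" for A B
      proof -
        have "B \<inter> {..<j} \<subseteq> A \<inter> {..<j}" using that by blast
        then show ?thesis using that compact_family_subset[OF K] by (simp add: tr_def)
      qed
      show "A \<in> tr K j" if "\<forall>t. finite t \<and> t \<subseteq> A \<longrightarrow> t \<in> tr K j" for A
      proof -
        have "A \<inter> {..<j} \<in> tr K j" using that by simp
        then show ?thesis by (simp add: tr_def)
      qed
    qed
    show "decseq (tr K)"
    proof (rule decseq_SucI, rule subsetI)
      fix j A assume "A \<in> tr K (Suc j)"
      moreover have "A \<inter> {..<j} \<subseteq> A \<inter> {..<Suc j}" by auto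
      ultimately show "A \<in> tr K j" using compact_family_subset[OF K] by (simp add: tr_def)
    qed
    show "(\<Inter>j. tr K j) = K"
    proof (intro equalityI subsetI)
      fix A assume A: "A \<in> (\<Inter>j. tr K j)"
      show "A \<in> K"
      proof (rule compact_family_closed[OF K])
        fix t assume t: "finite t" "t \<subseteq> A"
        obtain k where "\<And>x. x \<in> t \<Longrightarrow> x < k" using t(1) unfolding finite_nat_set_iff_bounded by blast
        then have "t \<subseteq> A \<inter> {..<k}" using t by blast
        moreover have "A \<inter> {..<k} \<in> K" using A by (auto simp: tr_def)
        ultimately show "t \<in> K" using compact_family_subset[OF K] by blast
      qed
    next
      fix A assume "A \<in> K"
      then have "A \<inter> {..<j} \<in> K" for j
        by (rule compact_family_subset[OF K]) simp
      then show "A \<in> (\<Inter>j. tr K j)" by (simp add: tr_def)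
    qed
  qed
  show ?thesis
    unfolding compact_family_def
  proof (intro conjI ballI allI impI)
    show "{} \<in> joins K M" using assms[THEN compact_family_empty] by (auto simp: joins_def)
  next
    fix A B assume "A \<in> joins K M" "B \<subseteq> A"
    then obtain A1 A2 where A: "A1 \<in> K" "A2 \<in> M" "B \<subseteq> A1 \<union> A2"
      by (auto simp: joins_def)
    have "B \<inter> A1 \<in> K" "B \<inter> A2 \<in> M"
      using compact_family_subset[OF K A(1)] compact_family_subset[OF M A(2)] by simp_all
    moreover have "B = (B \<inter> A1) \<union> (B \<inter> A2)" using A(3) by blast
    ultimately show "B \<in> joins K M" unfolding joins_def by blast
  next
    fix A assume A: "\<forall>t. finite t \<and> t \<subseteq> A \<longrightarrow> t \<in> joins K M"
    have "A \<in> joins (tr K j) (tr M j)" for j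
    proof -
      have "A \<inter> {..<j} \<in> joins K M" using A by simp
      then obtain B C where "B \<in> K" "C \<in> M" and BC: "A \<inter> {..<j} = B \<union> C"
        by (auto simp: joins_def)
      moreover have "(B \<union> (A - {..<j})) \<inter> {..<j} = B" "(C \<union> (A - {..<j})) \<inter> {..<j} = C"
        using BC by blast+
      ultimately have "B \<union> (A - {..<j}) \<in> tr K j" "C \<union> (A - {..<j}) \<in> tr M j"
        by (simp_all add: tr_def)
      moreover have "A = (B \<union> (A - {..<j})) \<union> (C \<union> (A - {..<j}))" using BC by blast
      ultimately show ?thesis unfolding joins_def by blast
    qed
    then have "A \<in> joins (\<Inter>j. tr K j) (\<Inter>j. tr M j)"
      by (rule joins_limit[OF tr(1,2)[OF K] tr(1,2)[OF M]])
    then show "A \<in> joins K M" using tr(3) assms by simp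
  qed
qed

text \<open>Lists rather than sets of families, so that one family may contribute several
  members.\<close>

primrec join_list :: "nat set set list \<Rightarrow> nat set set" where
  "join_list [] = {{}}"
| "join_list (K # l) = joins K (join_list l)"

lemma compact_family_join_list:
  "l \<in> lists (Collect compact_family) \<Longrightarrow> compact_family (join_list l)"
proof (induction l)
  case Nil
  show ?case using compact_family_Pow[of "{}"] by (simp only: Pow_empty join_list.simps)
next
  case (Cons K l)
  then show ?case by (simp add: compact_family_joins)
qed

lemma join_list_append: "join_list (l @ l') = joins (join_list l) (join_list l')"
proof (induction l)
  case Nil
  then show ?case by (auto simp: joins_def)
next
  case (Cons K l)
  have "joins K (joins M N) = joins (joins K M) N" for M N
  proof (intro equalityI subsetI)
    fix A assume "A \<in> joins K (joins M N)"
    then obtain B C D where "B \<in> K" "C \<in> M" "D \<in> N" "A = (B \<union> C) \<union> D"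
      by (auto simp: joins_def)
    then show "A \<in> joins (joins K M) N" unfolding joins_def by blast
  next
    fix A assume "A \<in> joins (joins K M) N"
    then obtain B C D where "B \<in> K" "C \<in> M" "D \<in> N" "A = B \<union> (C \<union> D)"
      by (auto simp: joins_def)
    then show "A \<in> joins K (joins M N)" unfolding joins_def by blast
  qed
  then show ?case using Cons by simp
qed

lemma join_list_replicate_mono:
  "K \<subseteq> M \<Longrightarrow> join_list (replicate m K) \<subseteq> join_list (replicate m M)"
  by (induction m) (simp_all add: joins_mono)

lemma join_list_replicate_limit:
  assumes "\<And>j. compact_family (K j)" "decseq K"
    and "\<And>j. A \<in> join_list (replicate m (K j))"
  shows "A \<in> join_list (replicate m (\<Inter>j. K j))"
  using assms(3)
proof (induction m arbitrary: A)
  case (Suc m)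
  have "compact_family (join_list (replicate m (K j)))" for j
    using assms(1) by (intro compact_family_join_list) (auto simp: in_lists_conv_set)
  moreover have "decseq (\<lambda>j. join_list (replicate m (K j)))"
    using assms(2) unfolding decseq_def by (blast dest: join_list_replicate_mono)
  ultimately have "A \<in> joins (\<Inter>j. K j) (\<Inter>j. join_list (replicate m (K j)))"
    using Suc.prems assms by (intro joins_limit) simp_all
  moreover have "(\<Inter>j. join_list (replicate m (K j))) \<subseteq> join_list (replicate m (\<Inter>j. K j))"
    using Suc.IH by blast
  ultimately have "A \<in> joins (\<Inter>j. K j) (join_list (replicate m (\<Inter>j. K j)))"
    by (rule subsetD[OF joins_mono[OF order_refl], rotated])
  then show ?case by simp
qed simp

section \<open>The ideal generated by compact families\<close>

definition ideal_gen :: "nat set set set \<Rightarrow> nat set set" where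
  "ideal_gen S = (\<Union>l\<in>lists S. join_list l)"

lemma ideal_gen_mono: "S \<subseteq> T \<Longrightarrow> ideal_gen S \<subseteq> ideal_gen T"
  unfolding ideal_gen_def by (intro UN_mono lists_mono order_refl)

lemma ideal_gen_empty: "{} \<in> ideal_gen S"
  unfolding ideal_gen_def by (rule UN_I[of "[]"]) auto

lemma ideal_gen_base: "K \<in> S \<Longrightarrow> A \<in> K \<Longrightarrow> A \<in> ideal_gen S"
  unfolding ideal_gen_def by (rule UN_I[of "[K]"]) (auto intro: joinsI)

lemma ideal_gen_Un:
  assumes "A \<in> ideal_gen S" "B \<in> ideal_gen S"
  shows "A \<union> B \<in> ideal_gen S"
proof -
  obtain l l' where "l \<in> lists S" "A \<in> join_list l" "l' \<in> lists S" "B \<in> join_list l'"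
    using assms unfolding ideal_gen_def by blast
  then have "l @ l' \<in> lists S" "A \<union> B \<in> join_list (l @ l')"
    unfolding join_list_append joins_def by auto
  then show ?thesis unfolding ideal_gen_def by blast
qed

lemma ideal_gen_subset:
  assumes "S \<subseteq> Collect compact_family" "A \<in> ideal_gen S" "B \<subseteq> A"
  shows "B \<in> ideal_gen S"
proof -
  obtain l where l: "l \<in> lists S" "A \<in> join_list l" using assms(2) unfolding ideal_gen_def by blast
  then have "l \<in> lists (Collect compact_family)" using assms(1) lists_mono by blast
  then have "B \<in> join_list l"
    using compact_family_subset[OF compact_family_join_list l(2) assms(3)] by simp
  then show ?thesis using l(1) unfolding ideal_gen_def by blast
qed

lemma ideal_gen_join_list_replicate:
  assumes "K \<subseteq> ideal_gen S"
  shows "join_list (replicate m K) \<subseteq> ideal_gen S"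
proof (induction m)
  case 0
  then show ?case by (simp add: ideal_gen_empty)
next
  case (Suc m)
  then show ?case using assms ideal_gen_Un unfolding replicate_Suc join_list.simps joins_def by blast
qed

text \<open>Unions commute, so the contributions of \<open>K\<close> can be gathered at the end.
  What remains is coded by a pair \<open>(l, m)\<close> in \<open>lists S \<times> UNIV\<close>,
  whatever \<open>K\<close> is.\<close>

lemma ideal_gen_insert:
  assumes "A \<in> ideal_gen (insert K S)"
  obtains l m where "l \<in> lists S" "A \<in> joins (join_list l) (join_list (replicate m K))"
proof -
  have "\<exists>l'\<in>lists S. \<exists>m. A \<in> joins (join_list l') (join_list (replicate m K))"
    if "l \<in> lists (insert K S)" "A \<in> join_list l" for l
    using that
  proof (induction l arbitrary: A)
    case Nil
    then have "A \<in> joins (join_list []) (join_list (replicate 0 K))" by (simp add: joins_def)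
    then show ?case by blast
  next
    case (Cons M l)
    from Cons.prems obtain C D where CD: "C \<in> M" "D \<in> join_list l" "A = C \<union> D"
      by (auto simp: joins_def)
    from Cons.IH[of D] Cons.prems CD(2) obtain l' m E F
      where l': "l' \<in> lists S" "E \<in> join_list l'" "F \<in> join_list (replicate m K)" "D = E \<union> F"
      by (auto simp: joins_def)
    show ?case
    proof (cases "M = K")
      case True
      then have "C \<union> F \<in> join_list (replicate (Suc m) K)"
        using CD(1) l'(3) by (auto intro: joinsI)
      moreover have "A = E \<union> (C \<union> F)" using CD(3) l'(4) by (simp add: Un_ac)
      ultimately have "A \<in> joins (join_list l') (join_list (replicate (Suc m) K))"
        using l'(2) by (blast intro: joinsI)
      then show ?thesis using l'(1) by blast
    next
      case False
      then have "M # l' \<in> lists S" using False Cons.hyps l'(1) by simp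
      moreover have "C \<union> E \<in> join_list (M # l')" using CD(1) l'(2) by (auto intro: joinsI)
      moreover have "A = (C \<union> E) \<union> F" using CD(3) l'(4) by (simp add: Un_ac)
      ultimately show ?thesis using l'(3) by (blast intro: joinsI)
    qed
  qed
  note ex = this
  obtain l where "l \<in> lists (insert K S)" "A \<in> join_list l"
    using assms unfolding ideal_gen_def by (elim UN_E)
  from ex[OF this] show ?thesis using that by (elim bexE exE)
qed

lemma ideal_gen_finitary:
  assumes "A \<in> ideal_gen S" obtains T where "finite T" "T \<subseteq> S" "A \<in> ideal_gen T"
proof -
  obtain l where "l \<in> lists S" "A \<in> join_list l" using assms unfolding ideal_gen_def by blast
  moreover from this have "set l \<subseteq> S" "l \<in> lists (set l)" by auto
  ultimately show ?thesis using that[of "set l"] unfolding ideal_gen_def by blast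
qed

text \<open>Finite unions of subsets of \<open>A\<close> are subsets of \<open>A\<close>, so the
  rest of the cover contains \<open>- A\<close>. Hence \<open>Pow A\<close> can be added whenever
  \<open>- A\<close> is not yet in the ideal.\<close>

lemma ideal_gen_insert_Pow:
  assumes "S \<subseteq> Collect compact_family" "UNIV \<in> ideal_gen (insert (Pow A) S)"
  shows "- A \<in> ideal_gen S"
proof -
  have R: "join_list (replicate m (Pow A)) \<subseteq> Pow A" for m
    by (induction m) (auto simp: joins_def)
  obtain l m where l: "l \<in> lists S" "UNIV \<in> joins (join_list l) (join_list (replicate m (Pow A)))"
    using ideal_gen_insert[OF assms(2)] by blast
  from l(2) obtain B C where "B \<in> join_list l" "C \<in> join_list (replicate m (Pow A))"
    "UNIV = B \<union> C"
    unfolding joins_def by blast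
  with l(1) have "B \<in> ideal_gen S" "C \<subseteq> A" "UNIV = B \<union> C"
    using R[of m] unfolding ideal_gen_def by blast+
  moreover from this have "- A \<subseteq> B" by blast
  ultimately show ?thesis using ideal_gen_subset[OF assms(1)] by simp
qed

section \<open>One step of the construction\<close>

text \<open>If no \<open>Pow (X n)\<close> can be added, all \<open>- X n\<close> lie in the ideal.
  Then \<open>Y\<close> is the union of an infinite set \<open>Q\<close> of finite sets, obtained as
  a pseudo-intersection in the countable space of lists.\<close>

lemma pseudo_intersection_step:
  fixes X :: "nat \<Rightarrow> nat set"
  assumes pc: "pseudo_intersection_number =o continuum"
    and S: "S \<subseteq> Collect compact_family" "|S| <o continuum" "UNIV \<notin> ideal_gen S"
  shows "(\<exists>n. UNIV \<notin> ideal_gen (insert (Pow (X n)) S)) \<or>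
    (\<exists>Y. (\<forall>n. finite (Y - X n)) \<and> UNIV \<notin> ideal_gen (insert (Pow (- Y)) S))"
proof (cases "\<exists>n. UNIV \<notin> ideal_gen (insert (Pow (X n)) S)")
  case False
  then have X: "- X n \<in> ideal_gen S" for n using ideal_gen_insert_Pow[OF S(1)] by blast
  have compact: "compact_family (join_list l)" if "l \<in> lists S" for l
    using compact_family_join_list that S(1) lists_mono by blast
  \<comment> \<open>One element of \<open>Q\<close> in \<open>T l\<close> keeps \<open>Y\<close> out
    of \<open>join_list l\<close>; having almost all elements of \<open>Q\<close> inside
    \<open>X n\<close> makes \<open>Y - X n\<close> finite.\<close>
  define T where "T = (\<lambda>l. {t. set t \<notin> join_list l})"
  define F where "F = T ` lists S \<union> range (\<lambda>n. {t. set t \<subseteq> X n})"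
  have "|lists S| \<le>o |lists S \<times> (UNIV :: nat set)|"
    by (rule card_of_Times1) simp
  then have "|lists S| <o continuum"
    using card_of_lists_Times_ordLess_continuum[OF S(2)] ordLeq_ordLess_trans by blast
  then have "|F| <o continuum"
    unfolding F_def by (intro card_of_Un_ordLess_continuum card_of_image_ordLess)
      (simp_all add: countable_ordLess_continuum)
  moreover have "infinite (\<Inter>G)" if G: "G \<subseteq> F" "finite G" for G
  proof -
    \<comment> \<open>Finitely many conditions reduce to a single list \<open>l\<close> and a single
      set \<open>B\<close> whose complement is in the ideal.\<close>
    have "\<exists>l\<in>lists S. \<exists>B. - B \<in> ideal_gen S \<and> (\<forall>t. set t \<subseteq> B \<and> set t \<notin> join_list l \<longrightarrow> t \<in> \<Inter>G)"
      using G(2,1)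
    proof (induction G)
      case empty
      have "[] \<in> lists S \<and> - UNIV \<in> ideal_gen S" using ideal_gen_empty by simp
      then show ?case by blast
    next
      case (insert H G)
      then have "G \<subseteq> F" by blast
      from insert.IH[OF this] obtain l B where l: "l \<in> lists S" and B: "- B \<in> ideal_gen S"
        and lB: "\<forall>t. set t \<subseteq> B \<and> set t \<notin> join_list l \<longrightarrow> t \<in> \<Inter>G"
        by (elim bexE exE conjE)
      have "H \<in> F" using insert.prems by blast
      then consider l' where "l' \<in> lists S" "H = T l'" | n where "H = {t. set t \<subseteq> X n}"
        by (auto simp: F_def)
      then show ?case
      proof cases
        case (1 l')
        have "A \<in> join_list (l @ l')" if "A \<in> join_list l \<or> A \<in> join_list l'" for A
          using that joinsI[OF _ compact_family_empty[OF compact[OF 1(1)]]]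
            joinsI[OF compact_family_empty[OF compact[OF l]]]
          unfolding join_list_append by auto
        then have "\<forall>t. set t \<subseteq> B \<and> set t \<notin> join_list (l @ l') \<longrightarrow> t \<in> \<Inter>(insert H G)"
          using lB 1(2) unfolding T_def by blast
        moreover have "l @ l' \<in> lists S" using l 1(1) by simp
        ultimately show ?thesis using B by blast
      next
        case (2 n)
        have "- (B \<inter> X n) \<in> ideal_gen S" using ideal_gen_Un[OF B X[of n]] by (simp add: Compl_Int)
        moreover have "\<forall>t. set t \<subseteq> B \<inter> X n \<and> set t \<notin> join_list l \<longrightarrow> t \<in> \<Inter>(insert H G)"
          using lB 2 by blast
        ultimately show ?thesis using l by blast
      qed
    qed
    then obtain l B where l: "l \<in> lists S" and B: "- B \<in> ideal_gen S"
        and lB: "\<forall>t. set t \<subseteq> B \<and> set t \<notin> join_list l \<longrightarrow> t \<in> \<Inter>G"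
      by (elim bexE exE conjE)
    \<comment> \<open>Otherwise \<open>B\<close> and its complement would cover everything;
      closedness of \<open>join_list l\<close> then yields a finite witness
      \<open>t\<close>.\<close>
    have "B \<notin> ideal_gen S" using ideal_gen_Un[OF B] S(3) by (metis Compl_partition2)
    then have "B \<notin> join_list l" using l unfolding ideal_gen_def by blast
    then obtain t where t: "finite t" "t \<subseteq> B" "t \<notin> join_list l"
      using compact_family_closed[OF compact[OF l]] by blast
    then obtain xs where xs: "set xs = t" using finite_list by blast
    have "t \<noteq> {}" using t compact_family_empty[OF compact[OF l]] by blast
    then obtain x where x: "x \<in> t" by blast
    \<comment> \<open>Padding with repetitions of \<open>x\<close> gives infinitely many lists with
      the same underlying set \<open>t\<close>.\<close>
    have "range (\<lambda>k. replicate k x @ xs) \<subseteq> \<Inter>G"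
    proof
      fix ys assume "ys \<in> range (\<lambda>k. replicate k x @ xs)"
      then have "set ys = t" using xs x by (auto split: if_splits)
      then show "ys \<in> \<Inter>G" using lB t by blast
    qed
    moreover have "inj (\<lambda>k. replicate k x @ xs)"
      by (rule injI) (metis append_same_eq length_replicate)
    ultimately show ?thesis using finite_subset range_inj_infinite by blast
  qed
  ultimately obtain Q where Q: "infinite Q" "\<And>A. A \<in> F \<Longrightarrow> finite (Q - A)"
    using pseudo_intersection_exists[OF pc, of F] infinite_UNIV_listI by blast
  define Y where "Y = (\<Union>t\<in>Q. set t)"
  have "finite (Y - X n)" for n
  proof -
    have "finite (Q - {t. set t \<subseteq> X n})" by (rule Q(2)) (auto simp: F_def)
    then have "finite (\<Union>t\<in>Q - {t. set t \<subseteq> X n}. set t)" by simp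
    moreover have "Y - X n \<subseteq> (\<Union>t\<in>Q - {t. set t \<subseteq> X n}. set t)" unfolding Y_def by blast
    ultimately show ?thesis using finite_subset by blast
  qed
  moreover have "Y \<notin> ideal_gen S"
  proof
    assume "Y \<in> ideal_gen S"
    then obtain l where l: "l \<in> lists S" "Y \<in> join_list l" unfolding ideal_gen_def by blast
    have "finite (Q - T l)" by (rule Q(2)) (use l in \<open>auto simp: F_def\<close>)
    then have "Q \<inter> T l \<noteq> {}" using Q(1) by (metis Diff_triv)
    then obtain t where "t \<in> Q" "set t \<notin> join_list l" by (auto simp: T_def)
    moreover from this have "set t \<subseteq> Y" by (auto simp: Y_def)
    ultimately show False using compact_family_subset[OF compact[OF l(1)] l(2)] by blast
  qed
  ultimately show ?thesis using ideal_gen_insert_Pow[OF S(1), of "- Y"] by (metis double_complement)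
qed simp

text \<open>A set \<open>L\<close> of triples is read as the relation \<open>f(t)(n) \<ge> j\<close> for a function \<open>f\<close> which assigns to each finite
  set a function with values in \<open>\<omega> \<union> {\<infinity>}\<close>. Finite sets are represented by lists, so that there are
  only continuum many such relations.\<close>

definition level :: "(nat list \<times> nat \<times> nat) set \<Rightarrow> nat \<Rightarrow> nat \<Rightarrow> nat set set" where
  "level L n j = {A. \<forall>t. set t \<subseteq> A \<longrightarrow> (t, n, j) \<in> L}"

text \<open>The first condition puts the empty set into every \<open>level L n j\<close>, the second
  makes these families decrease in \<open>j\<close>.\<close>

definition levels :: "(nat list \<times> nat \<times> nat) set \<Rightarrow> bool" where
  "levels L \<longleftrightarrow> (\<forall>n j. ([], n, j) \<in> L) \<and>
     (\<forall>t n i j. (t, n, j) \<in> L \<longrightarrow> i \<le> j \<longrightarrow> (t, n, i) \<in> L)"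

lemma compact_family_level:
  assumes "levels L"
  shows "compact_family (level L n j)"
  unfolding compact_family_def
proof (intro conjI ballI allI impI)
  show "{} \<in> level L n j" using assms by (simp add: level_def levels_def)
  show "B \<in> level L n j" if "A \<in> level L n j" "B \<subseteq> A" for A B
    using that by (auto simp: level_def)
  show "A \<in> level L n j" if A: "\<forall>t. finite t \<and> t \<subseteq> A \<longrightarrow> t \<in> level L n j" for A
  proof -
    have "(t, n, j) \<in> L" if "set t \<subseteq> A" for t
      using A[rule_format, of "set t"] that by (auto simp: level_def)
    then show ?thesis by (simp add: level_def)
  qed
qed

lemma compact_family_INT:
  assumes K: "\<And>j. compact_family (K j)"
  shows "compact_family (\<Inter>j. K j)"
  unfolding compact_family_def
proof (intro conjI ballI allI impI)
  show "{} \<in> (\<Inter>j. K j)" using compact_family_empty[OF K] by simp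
  show "B \<in> (\<Inter>j. K j)" if "A \<in> (\<Inter>j. K j)" "B \<subseteq> A" for A B
    using compact_family_subset[OF K _ that(2)] that(1) by simp
  show "A \<in> (\<Inter>j. K j)" if "\<forall>t. finite t \<and> t \<subseteq> A \<longrightarrow> t \<in> (\<Inter>j. K j)" for A
  proof
    show "A \<in> K j" for j
      by (rule compact_family_closed[OF K]) (use that in simp)
  qed
qed

text \<open>If both alternatives fail, every set lying in \<open>level L n j\<close> for all
  \<open>j\<close> is in the ideal. By compactness each \<open>(l, m)\<close> then accounts only for
  a bounded set of functions \<open>h\<close>, and fewer than continuum many bounds leave some
  \<open>h\<close> unaccounted for.\<close>

lemma escape_step:
  assumes pc: "pseudo_intersection_number =o continuum"
    and S: "S \<subseteq> Collect compact_family" "|S| <o continuum" "UNIV \<notin> ideal_gen S"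
    and L: "levels L"
  shows "(\<exists>n P. (\<forall>j. P \<in> level L n j) \<and> UNIV \<notin> ideal_gen (insert (Pow (- P)) S)) \<or>
    (\<exists>h. UNIV \<notin> ideal_gen (insert (\<Inter>n. level L n (h n)) S))"
proof (rule ccontr)
  assume "\<not> ?thesis"
  then have null: "\<And>n P. (\<forall>j. P \<in> level L n j) \<Longrightarrow> UNIV \<in> ideal_gen (insert (Pow (- P)) S)"
    and fill: "\<And>h. UNIV \<in> ideal_gen (insert (\<Inter>n. level L n (h n)) S)" by blast+
  have null: "(\<Inter>j. level L n j) \<subseteq> ideal_gen S" for n
  proof
    fix P assume "P \<in> (\<Inter>j. level L n j)"
    then have "UNIV \<in> ideal_gen (insert (Pow (- P)) S)" using null[of P n] by simp
    from ideal_gen_insert_Pow[OF S(1) this] show "P \<in> ideal_gen S" by simp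
  qed
  define H where "H = (\<lambda>(l, m). {h. UNIV \<in> joins (join_list l) (join_list (replicate m (\<Inter>n. level L n (h n))))})"
  note compact = compact_family_level[OF L]
  have dec: "decseq (level L n)" for n
    unfolding decseq_def level_def using L unfolding levels_def by blast
  have "\<exists>e. \<forall>h\<in>H (l, m). h \<le> e" if l: "l \<in> lists S" for l m
  proof -
    have "\<exists>b. \<forall>h\<in>H (l, m). h n \<le> b" for n
    proof (rule ccontr)
      assume unbounded: "\<not> ?thesis"
      \<comment> \<open>Unboundedness at \<open>n\<close> supplies \<open>h\<close> with
        \<open>j \<le> h n\<close>, whose family lies inside \<open>level L n j\<close>. So the same
        \<open>l\<close> and \<open>m\<close> work for every \<open>j\<close>, and \<open>j\<close>
        can tend to infinity.\<close>
      have "UNIV \<in> joins (join_list l) (join_list (replicate m (level L n j)))" for j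
      proof -
        obtain h where h: "h \<in> H (l, m)" "j \<le> h n" using unbounded by (meson nat_le_linear)
        have "(\<Inter>n. level L n (h n)) \<subseteq> level L n j" using decseqD[OF dec h(2)] by blast
        from joins_mono[OF order_refl join_list_replicate_mono[OF this]]
        show ?thesis using h(1) unfolding H_def by blast
      qed
      then have "UNIV \<in> joins (\<Inter>j :: nat. join_list l) (\<Inter>j. join_list (replicate m (level L n j)))"
      proof (intro joins_limit)
        show "compact_family (join_list l)"
          using l S(1) compact_family_join_list lists_mono by blast
        show "compact_family (join_list (replicate m (level L n j)))" for j
          using compact by (intro compact_family_join_list) (auto simp: in_lists_conv_set)
        show "decseq (\<lambda>j. join_list (replicate m (level L n j)))"
          using dec[of n] unfolding decseq_def by (blast dest: join_list_replicate_mono)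
      qed (auto simp: decseq_def)
      then obtain B C where BC: "B \<in> join_list l" "\<And>j. C \<in> join_list (replicate m (level L n j))" "UNIV = B \<union> C"
        by (auto simp: joins_def)
      have "C \<in> join_list (replicate m (\<Inter>j. level L n j))"
        by (rule join_list_replicate_limit[OF compact dec BC(2)])
      then have "C \<in> ideal_gen S" using ideal_gen_join_list_replicate[OF null] by blast
      moreover have "B \<in> ideal_gen S" using BC(1) l unfolding ideal_gen_def by blast
      ultimately show False using ideal_gen_Un S(3) BC(3) by metis
    qed
    then obtain e where "\<And>n h. h \<in> H (l, m) \<Longrightarrow> h n \<le> e n" by metis
    then show ?thesis by (auto simp: le_fun_def)
  qed
  then have "\<forall>p\<in>lists S \<times> UNIV. \<exists>e. \<forall>h\<in>H p. h \<le> e" by auto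
  then obtain e where e: "\<And>p h. p \<in> lists S \<times> UNIV \<Longrightarrow> h \<in> H p \<Longrightarrow> h \<le> e p"
    unfolding bchoice_iff by blast
  have "|e ` (lists S \<times> UNIV)| <o continuum"
    by (rule card_of_image_ordLess[OF card_of_lists_Times_ordLess_continuum[OF S(2)]])
  then obtain h where h: "\<And>f. f \<in> e ` (lists S \<times> UNIV) \<Longrightarrow> \<not> h \<le> f"
    by (rule not_dominated[OF pc]) (rule that)
  obtain l m where "l \<in> lists S" "UNIV \<in> joins (join_list l) (join_list (replicate m (\<Inter>n. level L n (h n))))"
    using ideal_gen_insert[OF fill[of h]] by blast
  then have "(l, m) \<in> lists S \<times> UNIV" "h \<in> H (l, m)" by (simp_all add: H_def)
  then show False using e h by blast
qed

section \<open>The transfinite construction\<close>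

text \<open>Recursion along the cardinal well-order of \<open>R\<close>: fewer than continuum many
  families are chosen before \<open>x\<close>, so \<open>step\<close> applies to them together with
  \<open>S0\<close>.\<close>

lemma ideal_gen_recursion:
  fixes C :: "'r \<Rightarrow> nat set set set"
  assumes S0: "S0 \<subseteq> Collect compact_family" "|S0| <o continuum" "UNIV \<notin> ideal_gen S0"
    and R: "|R| \<le>o continuum"
    and step: "\<And>x S. x \<in> R \<Longrightarrow> S \<subseteq> Collect compact_family \<Longrightarrow> |S| <o continuum \<Longrightarrow>
      UNIV \<notin> ideal_gen S \<Longrightarrow> \<exists>K\<in>C x. compact_family K \<and> UNIV \<notin> ideal_gen (insert K S)"
  obtains S where "S0 \<subseteq> S" "S \<subseteq> Collect compact_family" "UNIV \<notin> ideal_gen S"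
    "\<And>x. x \<in> R \<Longrightarrow> \<exists>K\<in>C x. K \<in> S"
proof -
  define r where "r = |R|"
  have r: "Well_order r" "Field r = R" "Card_order r"
    unfolding r_def by (rule card_of_Well_order Field_card_of card_of_Card_order)+
  have total: "(x, y) \<in> r \<or> (y, x) \<in> r" if "x \<in> R" "y \<in> R" for x y
    using that r(1,2) unfolding well_order_on_def linear_order_on_def partial_order_on_def
      preorder_on_def total_on_def refl_on_def by metis
  have trans: "trans r"
    using r(1) unfolding well_order_on_def linear_order_on_def partial_order_on_def preorder_on_def
    by blast
  \<comment> \<open>Outside \<open>R\<close> the condition is void, which makes the choice function
    total.\<close>
  define P where "P = (\<lambda>f x K. x \<in> R \<longrightarrow> K \<in> C x \<and> compact_family K \<and>
    UNIV \<notin> ideal_gen (insert K (S0 \<union> f ` underS r x)))"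
  \<comment> \<open>Only finitely many families are involved in covering \<open>UNIV\<close>; if
    some come from \<open>f\<close>, the largest index \<open>m\<close> among them contradicts
    \<open>P f m (f m)\<close>.\<close>
  have consistent: "UNIV \<notin> ideal_gen (S0 \<union> f ` A)"
    if A: "A \<subseteq> R" "\<And>y. y \<in> A \<Longrightarrow> P f y (f y)" for f A
  proof
    assume "UNIV \<in> ideal_gen (S0 \<union> f ` A)"
    then obtain T where T: "finite T" "T \<subseteq> S0 \<union> f ` A" "UNIV \<in> ideal_gen T"
      by (rule ideal_gen_finitary)
    then have "finite (T - S0)" "T - S0 \<subseteq> f ` A" by auto
    then obtain B where B: "B \<subseteq> A" "finite B" "T - S0 = f ` B"
      by (meson finite_subset_image)
    show False
    proof (cases "B = {}")
      case True
      then have "T \<subseteq> S0" using B(3) by auto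
      from subsetD[OF ideal_gen_mono[OF this] T(3)] S0(3) show False by contradiction
    next
      case False
      have "\<exists>m\<in>B. \<forall>y\<in>B. (y, m) \<in> r"
        using B(2) False subset_trans[OF B(1) A(1)]
      proof (induction rule: finite_ne_induct)
        case (singleton x)
        then show ?case using total[of x x] by auto
      next
        case (insert x F)
        then obtain m where m: "m \<in> F" "\<And>y. y \<in> F \<Longrightarrow> (y, m) \<in> r" by auto
        have "x \<in> R" "m \<in> R" using insert.prems m(1) by auto
        then consider "(x, m) \<in> r" | "(m, x) \<in> r" using total by blast
        then show ?case
        proof cases
          case 1
          then show ?thesis using m by auto
        next
          case 2
          then have "(y, x) \<in> r" if "y \<in> F" for y using transD[OF trans m(2)[OF that]] by blast
          moreover have "(x, x) \<in> r" using total[of x x] \<open>x \<in> R\<close> by blast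
          ultimately show ?thesis by blast
        qed
      qed
      then obtain m where m: "m \<in> B" "\<And>y. y \<in> B \<Longrightarrow> (y, m) \<in> r" by blast
      have fB: "f ` B \<subseteq> insert (f m) (f ` underS r m)" using m(2) unfolding underS_def by blast
      have "T \<subseteq> S0 \<union> f ` B" unfolding B(3)[symmetric] by blast
      from subset_trans[OF this Un_mono[OF subset_refl fB]]
      have "T \<subseteq> insert (f m) (S0 \<union> f ` underS r m)" by simp
      from subsetD[OF ideal_gen_mono[OF this] T(3)]
      have "UNIV \<in> ideal_gen (insert (f m) (S0 \<union> f ` underS r m))" .
      moreover have "m \<in> R" "P f m (f m)" using subsetD[OF B(1) m(1)] A by auto
      ultimately show False unfolding P_def by simp
    qed
  qed
  have "\<exists>f. \<forall>x. P f x (f x)"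
  proof (rule dependent_wf_choice)
    show "wf (r - Id)" using r(1) by (simp add: well_order_on_def)
    show "P f x K = P g x K" if "\<And>z. (z, x) \<in> r - Id \<Longrightarrow> f z = g z" for f g x K
    proof -
      have "f ` underS r x = g ` underS r x" using that unfolding underS_def by (intro image_cong) auto
      then show ?thesis unfolding P_def by simp
    qed
    show "\<exists>K. P f x K" if IH: "\<And>y. (y, x) \<in> r - Id \<Longrightarrow> P f y (f y)" for x f
    proof (cases "x \<in> R")
      case True
      have sub: "underS r x \<subseteq> R" using r(2) unfolding underS_def Field_def by blast
      have IH': "P f y (f y)" if "y \<in> underS r x" for y
        using IH that unfolding underS_def by blast
      have "|underS r x| <o continuum"
        using ordLess_ordLeq_trans[OF card_of_underS[OF r(3), of x] R[folded r_def]] True r(2) by simp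
      then have "|S0 \<union> f ` underS r x| <o continuum"
        by (intro card_of_Un_ordLess_continuum card_of_image_ordLess S0(2))
      moreover have "S0 \<union> f ` underS r x \<subseteq> Collect compact_family"
      proof (intro Un_least S0(1) image_subsetI)
        show "f y \<in> Collect compact_family" if "y \<in> underS r x" for y
          using IH'[OF that] subsetD[OF sub that] by (simp add: P_def)
      qed
      ultimately have "\<exists>K\<in>C x. compact_family K \<and> UNIV \<notin> ideal_gen (insert K (S0 \<union> f ` underS r x))"
        by (intro step[OF True] consistent[OF sub IH'])
      then show ?thesis unfolding P_def by blast
    qed (simp add: P_def)
  qed
  then obtain f where f: "\<And>x. P f x (f x)" by blast
  show ?thesis
  proof
    show "UNIV \<notin> ideal_gen (S0 \<union> f ` R)" by (rule consistent[OF subset_refl f])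
    show "S0 \<union> f ` R \<subseteq> Collect compact_family"
      using f by (intro Un_least S0(1) image_subsetI) (simp add: P_def)
    show "\<exists>K\<in>C x. K \<in> S0 \<union> f ` R" if "x \<in> R" for x using f[of x] that unfolding P_def by blast
  qed simp
qed

text \<open>The second property rules out a Tukey map \<open>g\<close>: letting \<open>t\<close> exhaust \<open>P\<close> and \<open>j\<close> grow, the functions
  \<open>h\<close> have no bounded subsequence, whereas their images \<open>g h\<close> have one that is bounded in \<open>U\<close>.\<close>

lemma p_point_exists:
  assumes pc: "pseudo_intersection_number =o continuum"
  obtains U where "p_point U"
    "\<And>g :: (nat \<Rightarrow> nat) \<Rightarrow> nat set. range g \<subseteq> U \<Longrightarrow>
      \<exists>n. \<exists>P\<in>U. \<forall>j t. finite t \<longrightarrow> t \<subseteq> P \<longrightarrow> (\<exists>h. j \<le> h n \<and> t \<subseteq> g h)"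
proof -
  \<comment> \<open>The requirements: a sequence \<open>X\<close> asks for an outcome of
    \<open>pseudo_intersection_step\<close>, a trace \<open>L\<close> for one of
    \<open>escape_step\<close>.\<close>
  define C where "C = case_sum
    (\<lambda>X :: nat \<Rightarrow> nat set. range (\<lambda>n. Pow (X n)) \<union> {Pow (- Y) |Y. \<forall>n. finite (Y - X n)})
    (\<lambda>L. {Pow (- P) |n P. \<forall>j. P \<in> level L n j} \<union> range (\<lambda>h. \<Inter>n. level L n (h n)))"
  \<comment> \<open>Starting with the singletons puts all finite sets into the ideal, which makes
    \<open>U\<close> nonprincipal.\<close>
  define S0 :: "nat set set set" where "S0 = range (\<lambda>n. Pow {n})"
  have "join_list l \<subseteq> Collect finite" if "l \<in> lists S0" for l
    using that
  proof induction
    case (Cons K l)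
    then obtain n where "K = Pow {n}" by (auto simp: S0_def)
    then have "K \<subseteq> Collect finite" using finite_subset by auto
    then show ?case using Cons.IH unfolding join_list.simps joins_def by blast
  qed simp
  then have S0: "UNIV \<notin> ideal_gen S0" unfolding ideal_gen_def by blast
  have "|UNIV :: (nat \<Rightarrow> nat set) set| \<le>o |UNIV :: (nat \<times> nat) set set|"
    by (rule card_of_ordLeqI[of "\<lambda>X. {(n, k). k \<in> X n}"]) (auto simp: inj_on_def set_eq_iff fun_eq_iff)
  then have X: "|UNIV :: (nat \<Rightarrow> nat set) set| \<le>o continuum"
    using card_of_sets_ordLeq_continuum ordLeq_transitive by blast
  have R: "|UNIV <+> Collect levels :: ((nat \<Rightarrow> nat set) + (nat list \<times> nat \<times> nat) set) set| \<le>o continuum"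
    by (intro card_of_Plus_ordLeq_infinite_Field[OF infinite_Field_continuum _ _ Card_order_continuum]
        X card_of_sets_ordLeq_continuum)
  obtain S where S: "S0 \<subseteq> S" "S \<subseteq> Collect compact_family" "UNIV \<notin> ideal_gen S"
    and SC: "\<And>x. x \<in> UNIV <+> Collect levels \<Longrightarrow> \<exists>K\<in>C x. K \<in> S"
  proof (rule ideal_gen_recursion[OF _ _ S0 R])
    show "S0 \<subseteq> Collect compact_family" unfolding S0_def using compact_family_Pow by blast
    show "|S0| <o continuum" unfolding S0_def by (simp add: countable_ordLess_continuum)
    show "\<exists>K\<in>C x. compact_family K \<and> UNIV \<notin> ideal_gen (insert K S)"
      if x: "x \<in> UNIV <+> Collect levels" and S: "S \<subseteq> Collect compact_family" "|S| <o continuum"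
        "UNIV \<notin> ideal_gen S" for x S
    proof (cases x)
      case (Inl X)
      from pseudo_intersection_step[OF pc S, of X] show ?thesis
      proof (elim disjE exE conjE)
        fix n assume "UNIV \<notin> ideal_gen (insert (Pow (X n)) S)"
        moreover have "Pow (X n) \<in> C x" by (simp add: C_def Inl)
        ultimately show ?thesis using compact_family_Pow by blast
      next
        fix Y assume "\<forall>n. finite (Y - X n)" "UNIV \<notin> ideal_gen (insert (Pow (- Y)) S)"
        moreover from this have "Pow (- Y) \<in> C x" by (auto simp: C_def Inl)
        ultimately show ?thesis using compact_family_Pow by blast
      qed
    next
      case (Inr L)
      then have L: "levels L" using x by auto
      from escape_step[OF pc S L] show ?thesis
      proof (elim disjE exE conjE)
        fix n P assume "\<forall>j. P \<in> level L n j" "UNIV \<notin> ideal_gen (insert (Pow (- P)) S)"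
        moreover from this have "Pow (- P) \<in> C x" by (auto simp: C_def Inr)
        ultimately show ?thesis using compact_family_Pow by blast
      next
        fix h assume "UNIV \<notin> ideal_gen (insert (\<Inter>n. level L n (h n)) S)"
        moreover have "(\<Inter>n. level L n (h n)) \<in> C x" by (simp add: C_def Inr)
        moreover have "compact_family (\<Inter>n. level L n (h n))"
          by (intro compact_family_INT compact_family_level L)
        ultimately show ?thesis by blast
      qed
    qed
  qed (rule that)
  define U where "U = {A. - A \<in> ideal_gen S}"
  have finite_null: "A \<in> ideal_gen S" if "finite A" for A
    using that
  proof induction
    case (insert x A)
    have "{x} \<in> ideal_gen S" by (rule ideal_gen_base[of "Pow {x}"]) (use S(1) in \<open>auto simp: S0_def\<close>)
    then show ?case using ideal_gen_Un[OF _ insert.IH, of "{x}"] by simp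
  qed (rule ideal_gen_empty)
  have pseudo: "\<exists>n. X n \<in> ideal_gen S \<or> (\<exists>Y\<in>U. \<forall>n. finite (Y - X n))" for X :: "nat \<Rightarrow> nat set"
  proof -
    obtain K where K: "K \<in> C (Inl X)" "K \<in> S" using SC[of "Inl X"] by blast
    from K(1) consider n where "K = Pow (X n)" | Y where "K = Pow (- Y)" "\<forall>n. finite (Y - X n)"
      by (auto simp: C_def)
    then show ?thesis
    proof cases
      case (1 n)
      then have "X n \<in> ideal_gen S" using ideal_gen_base[OF K(2)] by simp
      then show ?thesis by blast
    next
      case (2 Y)
      then have "- Y \<in> ideal_gen S" using ideal_gen_base[OF K(2)] by simp
      then show ?thesis using 2(2) unfolding U_def by blast
    qed
  qed
  have ultra: "ultrafilter U"
    unfolding ultrafilter_def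
  proof (intro conjI ballI allI impI)
    show "UNIV \<in> U" using ideal_gen_empty by (simp add: U_def)
    show "{} \<notin> U" using S(3) by (simp add: U_def)
    show "B \<in> U" if "A \<in> U" "A \<subseteq> B" for A B
      using that ideal_gen_subset[OF S(2), of "- A" "- B"] by (simp add: U_def)
    show "A \<inter> B \<in> U" if "A \<in> U" "B \<in> U" for A B
      using that ideal_gen_Un[of "- A" S "- B"] by (simp add: U_def Compl_Int)
    show "A \<in> U \<or> - A \<in> U" for A
    proof (cases "A \<in> ideal_gen S")
      case True
      then show ?thesis by (simp add: U_def)
    next
      case False
      \<comment> \<open>Maximality comes from the constant sequence at \<open>A\<close>: if
        \<open>A\<close> is not in the ideal, some \<open>Y \<in> U\<close> is almost contained in
        \<open>A\<close>.\<close>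
      then obtain Y where Y: "- Y \<in> ideal_gen S" "finite (Y - A)"
        using pseudo[of "\<lambda>_. A"] unfolding U_def by auto
      have "- A \<subseteq> - Y \<union> (Y - A)" by blast
      then have "- A \<in> ideal_gen S"
        using ideal_gen_subset[OF S(2) ideal_gen_Un[OF Y(1) finite_null[OF Y(2)]]] by blast
      then show ?thesis by (simp add: U_def)
    qed
  qed
  have disjoint: False if "A \<in> ideal_gen S" "A \<in> U" for A
    using ideal_gen_Un[OF that(1), of "- A"] that(2) S(3) by (simp add: U_def)
  show ?thesis
  proof
    show "p_point U"
      unfolding p_point_def
    proof (intro conjI allI impI ultra notI)
      assume "principal U"
      then obtain a where "U = {A. a \<in> A}" by (auto simp: principal_def)
      then have "{a} \<in> U" by blast
      then show False using disjoint[OF finite_null, of "{a}"] by simp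
    next
      fix X :: "nat \<Rightarrow> nat set" assume X: "\<forall>n. X n \<in> U"
      then show "\<exists>Y\<in>U. \<forall>n. finite (Y - X n)" using pseudo[of X] disjoint by blast
    qed
  next
    fix g :: "(nat \<Rightarrow> nat) \<Rightarrow> nat set" assume g: "range g \<subseteq> U"
    define L where "L = {(t, n, j). \<exists>h. j \<le> h n \<and> set t \<subseteq> g h}"
    have "levels L"
      unfolding levels_def L_def using le_trans by fastforce
    then obtain K where K: "K \<in> C (Inr L)" "K \<in> S" using SC[of "Inr L"] by blast
    from K(1) consider n P where "K = Pow (- P)" "\<forall>j. P \<in> level L n j"
      | h where "K = (\<Inter>n. level L n (h n))"
      by (auto simp: C_def)
    then show "\<exists>n. \<exists>P\<in>U. \<forall>j t. finite t \<longrightarrow> t \<subseteq> P \<longrightarrow> (\<exists>h. j \<le> h n \<and> t \<subseteq> g h)"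
    proof cases
      case (1 n P)
      have "- P \<in> ideal_gen S" using ideal_gen_base[OF K(2)] 1(1) by simp
      moreover have "\<exists>h. j \<le> h n \<and> t \<subseteq> g h" if t: "finite t" "t \<subseteq> P" for j t
      proof -
        obtain xs where "set xs = t" using finite_list[OF t(1)] by blast
        then show ?thesis using 1(2) t(2) unfolding level_def L_def by blast
      qed
      ultimately show ?thesis unfolding U_def by blast
    next
      case (2 h)
      \<comment> \<open>For \<open>set t \<subseteq> g h\<close> the function \<open>h\<close>
        itself witnesses \<open>(t, n, h n) \<in> L\<close>. So this outcome would put
        \<open>g h\<close> into the ideal although it is in \<open>U\<close>.\<close>
      have "g h \<in> K" unfolding 2 level_def L_def by blast
      then show ?thesis using disjoint ideal_gen_base[OF K(2)] g by blast
    qed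
  qed
qed

section \<open>Tukey reductions\<close>

lemma tukey_leI:
  assumes "f ` Field E \<subseteq> Field D"
    and "\<And>d. d \<in> Field D \<Longrightarrow> \<exists>e\<in>Field E. \<forall>e'. (e, e') \<in> E \<longrightarrow> (d, f e') \<in> D"
  shows "D \<le>\<^sub>T E"
proof -
  have "cofinal_subset D (f ` X)" if X: "cofinal_subset E X" for X
    unfolding cofinal_subset_def
  proof (intro conjI ballI)
    show "f ` X \<subseteq> Field D" using X assms(1) unfolding cofinal_subset_def by blast
    fix d assume "d \<in> Field D"
    then obtain e where e: "e \<in> Field E" "\<And>e'. (e, e') \<in> E \<Longrightarrow> (d, f e') \<in> D"
      using assms(2) by blast
    then obtain x where "x \<in> X" "(e, x) \<in> E" using X unfolding cofinal_subset_def by blast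
    then show "\<exists>y\<in>f ` X. (d, y) \<in> D" using e(2) by blast
  qed
  then show ?thesis unfolding tukey_le_def using assms(1) by blast
qed

text \<open>Converse of \<open>tukey_leI\<close>: if no \<open>e\<close> worked for
  \<open>d\<close>, the points whose image is not above \<open>d\<close> would form a cofinal set
  with a non-cofinal image.\<close>

lemma tukey_leE:
  assumes "D \<le>\<^sub>T E"
  obtains f where "f ` Field E \<subseteq> Field D"
    "\<And>d. d \<in> Field D \<Longrightarrow> \<exists>e\<in>Field E. \<forall>e'. (e, e') \<in> E \<longrightarrow> (d, f e') \<in> D"
proof -
  obtain f where f: "f ` Field E \<subseteq> Field D" "\<And>X. cofinal_subset E X \<Longrightarrow> cofinal_subset D (f ` X)"
    using assms unfolding tukey_le_def by blast
  have "\<exists>e\<in>Field E. \<forall>e'. (e, e') \<in> E \<longrightarrow> (d, f e') \<in> D" if d: "d \<in> Field D" for d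
  proof (rule ccontr)
    assume *: "\<not> ?thesis"
    define X where "X = {e \<in> Field E. (d, f e) \<notin> D}"
    have "\<exists>x\<in>X. (e, x) \<in> E" if "e \<in> Field E" for e
    proof -
      obtain e' where "(e, e') \<in> E" "(d, f e') \<notin> D" using * \<open>e \<in> Field E\<close> by blast
      then show ?thesis unfolding X_def Field_def by blast
    qed
    then have "cofinal_subset E X" unfolding cofinal_subset_def X_def by blast
    then have "cofinal_subset D (f ` X)" by (rule f(2))
    then obtain x where "x \<in> X" "(d, f x) \<in> D" using d unfolding cofinal_subset_def by blast
    then show False by (simp add: X_def)
  qed
  then show ?thesis using that f(1) by blast
qed

lemma tukey_le_trans: "C \<le>\<^sub>T D \<Longrightarrow> D \<le>\<^sub>T E \<Longrightarrow> C \<le>\<^sub>T E"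
proof -
  assume "C \<le>\<^sub>T D"
  then obtain f where f: "f ` Field D \<subseteq> Field C" "\<And>X. cofinal_subset D X \<Longrightarrow> cofinal_subset C (f ` X)"
    unfolding tukey_le_def by blast
  assume "D \<le>\<^sub>T E"
  then obtain g where g: "g ` Field E \<subseteq> Field D" "\<And>X. cofinal_subset E X \<Longrightarrow> cofinal_subset D (g ` X)"
    unfolding tukey_le_def by blast
  have "(f \<circ> g) ` Field E \<subseteq> Field C" using f(1) g(1) by auto
  moreover have "cofinal_subset C ((f \<circ> g) ` X)" if "cofinal_subset E X" for X
    using f(2)[OF g(2)[OF that]] by (simp add: image_comp)
  ultimately show ?thesis unfolding tukey_le_def by blast
qed

lemma in_reverse_inclusion: "(A, B) \<in> reverse_inclusion U \<longleftrightarrow> A \<in> U \<and> B \<in> U \<and> B \<subseteq> A"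
  by (auto simp: reverse_inclusion_def relation_of_def)

lemma in_baire_order: "(f, g) \<in> baire_order \<longleftrightarrow> f \<le> g"
  by (auto simp: baire_order_def relation_of_def)

lemma in_finite_subsets_order:
  "(F, G) \<in> finite_subsets_order r \<longleftrightarrow> F \<in> Fpow (Field r) \<and> G \<in> Fpow (Field r) \<and> F \<subseteq> G"
  by (auto simp: finite_subsets_order_def relation_of_def)

section \<open>Ultrafilters and their Fubini squares\<close>

lemma ultrafilter_UNIV: "ultrafilter U \<Longrightarrow> UNIV \<in> U"
  and ultrafilter_empty: "ultrafilter U \<Longrightarrow> {} \<notin> U"
  and ultrafilter_superset: "ultrafilter U \<Longrightarrow> A \<in> U \<Longrightarrow> A \<subseteq> B \<Longrightarrow> B \<in> U"
  and ultrafilter_Int: "ultrafilter U \<Longrightarrow> A \<in> U \<Longrightarrow> B \<in> U \<Longrightarrow> A \<inter> B \<in> U"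
  and ultrafilter_Compl: "ultrafilter U \<Longrightarrow> A \<notin> U \<Longrightarrow> - A \<in> U"
  unfolding ultrafilter_def by blast+

lemma ultrafilter_finite_INT:
  assumes "ultrafilter U" "finite I" "\<And>i. i \<in> I \<Longrightarrow> A i \<in> U"
  shows "(\<Inter>i\<in>I. A i) \<in> U"
  using assms(2,3)
proof (induction I)
  case empty
  then show ?case using ultrafilter_UNIV[OF assms(1)] by simp
next
  case (insert i I)
  then show ?case using ultrafilter_Int[OF assms(1), of "A i"] by simp
qed

lemma ultrafilter_cofinite:
  assumes U: "ultrafilter U" "\<not> principal U" and "finite A"
  shows "- A \<in> U"
proof -
  have "- {a} \<in> U" for a
  proof (rule ccontr)
    assume "- {a} \<notin> U"
    then have a: "{a} \<in> U" using ultrafilter_Compl[OF U(1)] by fastforce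
    have "A \<in> U \<longleftrightarrow> a \<in> A" for A
    proof
      assume "A \<in> U"
      then have "A \<inter> {a} \<noteq> {}" using ultrafilter_Int[OF U(1) _ a] ultrafilter_empty[OF U(1)] by metis
      then show "a \<in> A" by blast
    next
      assume "a \<in> A"
      then show "A \<in> U" using ultrafilter_superset[OF U(1) a] by blast
    qed
    then show False using U(2) unfolding principal_def by blast
  qed
  then have "(\<Inter>a\<in>A. - {a}) \<in> U" by (rule ultrafilter_finite_INT[OF U(1) \<open>finite A\<close>])
  moreover have "(\<Inter>a\<in>A. - {a}) = - A" by blast
  ultimately show ?thesis by simp
qed

abbreviation slice :: "('a \<times> 'a) set \<Rightarrow> 'a \<Rightarrow> 'a set" where
  "slice A i \<equiv> {j. (i, j) \<in> A}"

lemma fubini_square_Int: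
  assumes U: "ultrafilter U" and "A \<in> fubini_square U" "B \<in> fubini_square U"
  shows "A \<inter> B \<in> fubini_square U"
proof -
  have "{i. slice A i \<in> U} \<inter> {i. slice B i \<in> U} \<in> U"
    using assms(2,3) unfolding fubini_square_def by (simp add: ultrafilter_Int[OF U])
  moreover have "slice (A \<inter> B) i \<in> U" if "slice A i \<in> U" "slice B i \<in> U" for i
    using ultrafilter_Int[OF U that] by (simp add: Collect_conj_eq)
  ultimately have "{i. slice (A \<inter> B) i \<in> U} \<in> U"
    by (elim ultrafilter_superset[OF U]) blast
  then show ?thesis by (simp add: fubini_square_def)
qed

text \<open>Every member of the square inside the strip \<open>A \<times> UNIV\<close> has nonempty
  slices only over \<open>A\<close>.\<close>

lemma ultrafilter_tukey_le_fubini_square: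
  assumes U: "ultrafilter U"
  shows "reverse_inclusion U \<le>\<^sub>T reverse_inclusion (fubini_square U)"
proof (rule tukey_leI[where f = "\<lambda>A. {i. slice A i \<in> U}"])
  show "(\<lambda>A. {i. slice A i \<in> U}) ` Field (reverse_inclusion (fubini_square U)) \<subseteq> Field (reverse_inclusion U)"
    by (auto simp: Field_directed_sets fubini_square_def)
  fix A assume "A \<in> Field (reverse_inclusion U)"
  then have A: "A \<in> U" by (simp add: Field_directed_sets)
  have slice: "slice (A \<times> UNIV) i = (if i \<in> A then UNIV else {})" for i by auto
  have "A \<times> UNIV \<in> fubini_square U"
    unfolding fubini_square_def mem_Collect_eq slice
    using A ultrafilter_UNIV[OF U] ultrafilter_empty[OF U] by simp
  moreover have "{i. slice B i \<in> U} \<subseteq> A" if "B \<subseteq> A \<times> UNIV" for B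
  proof
    fix i assume "i \<in> {i. slice B i \<in> U}"
    then have "slice B i \<noteq> {}" using ultrafilter_empty[OF U] by (metis mem_Collect_eq)
    then show "i \<in> A" using that by blast
  qed
  ultimately show "\<exists>e\<in>Field (reverse_inclusion (fubini_square U)). \<forall>e'.
      (e, e') \<in> reverse_inclusion (fubini_square U) \<longrightarrow> (A, {i. slice e' i \<in> U}) \<in> reverse_inclusion U"
    using A unfolding Field_directed_sets in_reverse_inclusion
    by (intro bexI[of _ "A \<times> UNIV"]) (auto simp: fubini_square_def)
qed

text \<open>From a member \<open>A\<close> of the Fubini square read off the minimum of the first large slice at or
  above \<open>i\<close>. If \<open>A\<close> is contained in the region above the running maximum of \<open>h\<close>, this minimum is at least \<open>h(i)\<close>.\<close>

lemma baire_tukey_le_fubini_square: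
  fixes U :: "nat set set"
  assumes U: "ultrafilter U" "\<not> principal U"
  shows "baire_order \<le>\<^sub>T reverse_inclusion (fubini_square U)"
proof -
  define next_slice where "next_slice = (\<lambda>A i. LEAST k. i \<le> k \<and> slice A k \<in> U)"
  define f where "f = (\<lambda>A i. LEAST j. (next_slice A i, j) \<in> A)"
  show ?thesis
  proof (rule tukey_leI[where f = f])
    fix h :: "nat \<Rightarrow> nat"
    define G where "G = {(i, j). \<forall>k\<le>i. h k \<le> j}"
    have "slice G i \<in> U" for i
    proof -
      have "- {..<Max (h ` {..i})} \<subseteq> slice G i"
        by (auto simp: G_def not_less)
      then show ?thesis using ultrafilter_superset[OF U(1) ultrafilter_cofinite[OF U]] by blast
    qed
    then have G: "G \<in> fubini_square U" using ultrafilter_UNIV[OF U(1)] by (simp add: fubini_square_def)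
    moreover have "h \<le> f A" if A: "A \<in> fubini_square U" "A \<subseteq> G" for A
    proof (rule le_funI)
      fix i
      \<comment> \<open>Deleting the indices below \<open>i\<close> leaves a member of
        \<open>U\<close>, so the minimum defining \<open>next_slice A i\<close> exists.\<close>
      have "{k. slice A k \<in> U} \<inter> - {..<i} \<in> U"
        using A(1) by (intro ultrafilter_Int[OF U(1)] ultrafilter_cofinite[OF U])
          (simp_all add: fubini_square_def)
      then have "{k. slice A k \<in> U} \<inter> - {..<i} \<noteq> {}" using ultrafilter_empty[OF U(1)] by metis
      then have "\<exists>k. i \<le> k \<and> slice A k \<in> U" by (auto simp: not_less)
      then have "i \<le> next_slice A i \<and> slice A (next_slice A i) \<in> U"
        unfolding next_slice_def by (rule LeastI_ex)
      then have k: "i \<le> next_slice A i" "slice A (next_slice A i) \<in> U" by auto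
      then have "slice A (next_slice A i) \<noteq> {}" using ultrafilter_empty[OF U(1)] by metis
      then have "\<exists>j. (next_slice A i, j) \<in> A" by blast
      then have "(next_slice A i, f A i) \<in> A" unfolding f_def by (rule LeastI_ex)
      then show "h i \<le> f A i" using A(2) k(1) by (auto simp: G_def)
    qed
    ultimately show "\<exists>e\<in>Field (reverse_inclusion (fubini_square U)). \<forall>e'.
        (e, e') \<in> reverse_inclusion (fubini_square U) \<longrightarrow> (h, f e') \<in> baire_order"
      unfolding Field_directed_sets in_reverse_inclusion in_baire_order by blast
  qed (simp add: Field_directed_sets)
qed

text \<open>The square has at most continuum many members: enumerate them and send a finite set of
  indices to the intersection of the members it lists.\<close>

lemma fubini_square_tukey_le_top:
  fixes U :: "nat set set"
  assumes U: "ultrafilter U"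
  shows "reverse_inclusion (fubini_square U) \<le>\<^sub>T finite_subsets_order continuum"
proof -
  have UNIV: "UNIV \<in> fubini_square U"
    using ultrafilter_UNIV[OF U] by (simp add: fubini_square_def)
  have "|fubini_square U| \<le>o |UNIV :: (nat \<Rightarrow> bool) set|"
    using card_of_sets_ordLeq_continuum continuum_ordIso ordLeq_ordIso_trans by blast
  then obtain e :: "(nat \<Rightarrow> bool) \<Rightarrow> (nat \<times> nat) set" where e: "range e = fubini_square U"
    using card_of_ordLeq2[of "fubini_square U" "UNIV :: (nat \<Rightarrow> bool) set"] UNIV by blast
  have INT: "(\<Inter>x\<in>F. e x) \<in> fubini_square U" if "finite F" for F
    using that
  proof induction
    case (insert x F)
    then show ?case using fubini_square_Int[OF U, of "e x"] e by auto
  qed (simp add: UNIV)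
  show ?thesis
  proof (rule tukey_leI[where f = "\<lambda>F. \<Inter>x\<in>F. e x"])
    show "(\<lambda>F. \<Inter>x\<in>F. e x) ` Field (finite_subsets_order continuum)
        \<subseteq> Field (reverse_inclusion (fubini_square U))"
      using INT by (auto simp: Field_directed_sets Fpow_def)
    fix A assume "A \<in> Field (reverse_inclusion (fubini_square U))"
    then obtain x where x: "A = e x" using e by (auto simp: Field_directed_sets)
    have "(A, \<Inter>y\<in>F. e y) \<in> reverse_inclusion (fubini_square U)"
      if F: "({x}, F) \<in> finite_subsets_order continuum" for F
    proof -
      have "finite F" "x \<in> F" using F by (auto simp: in_finite_subsets_order Fpow_def)
      then have "(\<Inter>y\<in>F. e y) \<in> fubini_square U" "(\<Inter>y\<in>F. e y) \<subseteq> e x"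
        using INT by (simp, blast)
      moreover have "e x \<in> fubini_square U" using e by auto
      ultimately show ?thesis by (simp add: in_reverse_inclusion x)
    qed
    then show "\<exists>F\<in>Field (finite_subsets_order continuum). \<forall>G. (F, G) \<in> finite_subsets_order continuum \<longrightarrow>
        (A, \<Inter>y\<in>G. e y) \<in> reverse_inclusion (fubini_square U)"
      by (intro bexI[of _ "{x}"]) (auto simp: Field_directed_sets Fpow_def Field_continuum)
  qed
qed

section \<open>Convergent sequences in p-points\<close>

text \<open>Each \<open>A n\<close> misses only finitely many points of the pseudo-intersection
  \<open>Z\<close>. Convergence allows a choice of indices for which these missing sets are pairwise
  disjoint; the ultrafilter then decides whether the even or the odd ones can be avoided.\<close>

lemma p_point_bounded_subseq:
  assumes U: "p_point U" and A: "\<And>i. A i \<in> U" "converges A B" "B \<in> U"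
  obtains r :: "nat \<Rightarrow> nat" where "strict_mono r" "(\<Inter>i. A (r i)) \<in> U"
proof -
  have ultra: "ultrafilter U" using U by (simp add: p_point_def)
  obtain Y where Y: "Y \<in> U" "\<And>n. finite (Y - A n)"
    using U A(1) unfolding p_point_def by blast
  define Z where "Z = Y \<inter> B"
  have Z: "Z \<in> U" "\<And>n. finite (Z - A n)"
    using ultrafilter_Int[OF ultra Y(1) A(3)] Y(2) finite_subset[of "Z - A n" "Y - A n" for n]
    unfolding Z_def by blast+
  \<comment> \<open>\<open>p n\<close> consists of an index and a bound for the points of
    \<open>Z\<close> missing there; the next set must contain all of \<open>Z\<close> below this
    bound, which is possible because \<open>Z\<close> lies in the limit \<open>B\<close>.\<close>
  have "\<exists>p. \<forall>n. (Z - A (fst (p n)) \<subseteq> {..<snd (p n)}) \<and>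
    (fst (p n) < fst (p (Suc n)) \<and> snd (p n) \<le> snd (p (Suc n)) \<and> Z \<inter> {..<snd (p n)} \<subseteq> A (fst (p (Suc n))))"
  proof (rule dependent_nat_choice)
    obtain m where "\<forall>x\<in>Z - A 0. x < m" using Z(2)[of 0] unfolding finite_nat_set_iff_bounded by blast
    then show "\<exists>x. Z - A (fst x) \<subseteq> {..<snd x}" by (intro exI[of _ "(0, m)"]) auto
    fix x :: "nat \<times> nat" and n :: nat
    have "\<forall>\<^sub>F i in sequentially. Z \<inter> {..<snd x} \<subseteq> A i"
      by (rule converges_subset[OF A(2)]) (auto simp: Z_def)
    then obtain N where N: "\<And>i. i \<ge> N \<Longrightarrow> Z \<inter> {..<snd x} \<subseteq> A i"
      unfolding eventually_sequentially by blast
    define i where "i = max N (Suc (fst x))"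
    obtain m where m: "\<forall>y\<in>Z - A i. y < m" using Z(2)[of i] unfolding finite_nat_set_iff_bounded by blast
    show "\<exists>y. Z - A (fst y) \<subseteq> {..<snd y} \<and>
      (fst x < fst y \<and> snd x \<le> snd y \<and> Z \<inter> {..<snd x} \<subseteq> A (fst y))"
    proof (intro exI[of _ "(i, max m (snd x))"] conjI)
      show "Z \<inter> {..<snd x} \<subseteq> A (fst (i, max m (snd x)))" using N[of i] by (simp add: i_def)
    qed (use m in \<open>auto simp: i_def less_max_iff_disj\<close>)
  qed
  then obtain p where p: "\<And>n. Z - A (fst (p n)) \<subseteq> {..<snd (p n)}"
    "\<And>n. fst (p n) < fst (p (Suc n))" "\<And>n. snd (p n) \<le> snd (p (Suc n))"
    "\<And>n. Z \<inter> {..<snd (p n)} \<subseteq> A (fst (p (Suc n)))"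
    by blast
  define i where "i = fst \<circ> p"
  define m where "m = snd \<circ> p"
  have i: "strict_mono i" using p(2) by (simp add: i_def strict_mono_Suc_iff)
  have m: "mono m" using p(3) by (simp add: m_def mono_iff_le_Suc)
  define D where "D = (\<lambda>k. Z - A (i k))"
  have disjoint: "D k \<inter> D l = {}" if "k < l" for k l
  proof -
    obtain l' where l': "l = Suc l'" "k \<le> l'" using \<open>k < l\<close> by (cases l) auto
    have "D k \<subseteq> Z \<inter> {..<m l'}" using p(1)[of k] monoD[OF m l'(2)] by (auto simp: D_def i_def m_def)
    then show ?thesis using p(4)[of l'] l'(1) by (auto simp: D_def i_def m_def)
  qed
  \<comment> \<open>\<open>E\<close> collects the points missing at even positions. If
    \<open>E\<close> is in \<open>U\<close>, then \<open>Z \<inter> E\<close> bounds the odd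
    positions, otherwise \<open>Z \<inter> - E\<close> bounds the even ones.\<close>
  define E where "E = (\<Union>k. D (2 * k))"
  have "D (Suc (2 * k)) \<inter> D (2 * l) = {}" for k l
    using disjoint[of "Suc (2 * k)" "2 * l"] disjoint[of "2 * l" "Suc (2 * k)"]
    by (cases "Suc (2 * k) < 2 * l") (auto simp: not_less le_less dest: arg_cong[of _ _ even])
  then have odd: "D (Suc (2 * k)) \<inter> E = {}" for k unfolding E_def by blast
  show ?thesis
  proof (cases "E \<in> U")
    case True
    have "Z \<inter> E \<subseteq> (\<Inter>k. A (i (Suc (2 * k))))" using odd unfolding D_def by blast
    then have "(\<Inter>k. A ((i \<circ> (\<lambda>k. Suc (2 * k))) k)) \<in> U"
      using ultrafilter_superset[OF ultra ultrafilter_Int[OF ultra Z(1) True]] by simp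
    moreover have "strict_mono (i \<circ> (\<lambda>k. Suc (2 * k)))"
      by (intro strict_mono_o[OF i]) (simp add: strict_mono_def)
    ultimately show ?thesis using that by blast
  next
    case False
    then have "- E \<in> U" by (rule ultrafilter_Compl[OF ultra])
    moreover have "Z \<inter> - E \<subseteq> (\<Inter>k. A (i (2 * k)))" unfolding E_def D_def by blast
    ultimately have "(\<Inter>k. A ((i \<circ> (\<lambda>k. 2 * k)) k)) \<in> U"
      using ultrafilter_superset[OF ultra ultrafilter_Int[OF ultra Z(1)]] by simp
    moreover have "strict_mono (i \<circ> (\<lambda>k. 2 * k))"
      by (intro strict_mono_o[OF i]) (simp add: strict_mono_def)
    ultimately show ?thesis using that by blast
  qed
qed

text \<open>Functions \<open>h j\<close> with \<open>j \<le> h j n\<close> are chosen such that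
  \<open>g (h j)\<close> contains \<open>P\<close> below \<open>j\<close>. A limit of these sets
  contains \<open>P\<close>, so some subsequence has its intersection \<open>B\<close> in
  \<open>U\<close>, and \<open>f B n\<close> would bound every number.\<close>

lemma not_baire_tukey_le:
  assumes U: "p_point U"
    and escape: "\<And>g :: (nat \<Rightarrow> nat) \<Rightarrow> nat set. range g \<subseteq> U \<Longrightarrow>
      \<exists>n. \<exists>P\<in>U. \<forall>j t. finite t \<longrightarrow> t \<subseteq> P \<longrightarrow> (\<exists>h. j \<le> h n \<and> t \<subseteq> g h)"
  shows "\<not> baire_order \<le>\<^sub>T reverse_inclusion U"
proof
  assume "baire_order \<le>\<^sub>T reverse_inclusion U"
  then obtain f where f: "\<And>h. h \<in> Field baire_order \<Longrightarrow> \<exists>A\<in>Field (reverse_inclusion U).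
      \<forall>B. (A, B) \<in> reverse_inclusion U \<longrightarrow> (h, f B) \<in> baire_order"
    by (rule tukey_leE) (rule that)
  then have "\<forall>h. \<exists>A\<in>U. \<forall>B\<in>U. B \<subseteq> A \<longrightarrow> h \<le> f B"
    unfolding Field_directed_sets in_reverse_inclusion in_baire_order by (metis UNIV_I)
  then obtain g where g: "\<And>h. g h \<in> U" "\<And>h B. B \<in> U \<Longrightarrow> B \<subseteq> g h \<Longrightarrow> h \<le> f B" by metis
  have ultra: "ultrafilter U" using U by (simp add: p_point_def)
  obtain n P where P: "P \<in> U" "\<And>j t. finite t \<Longrightarrow> t \<subseteq> P \<Longrightarrow> \<exists>h. j \<le> h n \<and> t \<subseteq> g h"
    using escape[of g] g(1) by blast
  have "\<exists>h. j \<le> h n \<and> P \<inter> {..<j} \<subseteq> g h" for j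
    by (rule P(2)) auto
  then obtain h where h: "\<And>j. j \<le> h j n" "\<And>j. P \<inter> {..<j} \<subseteq> g (h j)" by metis
  obtain r X where r: "strict_mono r" "converges ((\<lambda>j. g (h j)) \<circ> r) X"
    by (rule convergent_subseq)
  have "P \<subseteq> X"
  proof
    fix x assume x: "x \<in> P"
    obtain N where N: "\<And>i. i \<ge> N \<Longrightarrow> x \<in> g (h (r i)) \<longleftrightarrow> x \<in> X"
      using r(2) unfolding converges_def eventually_sequentially comp_def by blast
    define i where "i = max N (Suc x)"
    have "x < r i" using seq_suble[OF r(1), of i] by (simp add: i_def)
    then have "x \<in> g (h (r i))" using h(2)[of "r i"] x by blast
    then show "x \<in> X" using N[of i] by (simp add: i_def)
  qed
  then have "X \<in> U" by (rule ultrafilter_superset[OF ultra P(1)])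
  then obtain s :: "nat \<Rightarrow> nat" where s: "strict_mono s" "(\<Inter>i. ((\<lambda>j. g (h j)) \<circ> r) (s i)) \<in> U"
    using p_point_bounded_subseq[OF U _ r(2)] g(1) unfolding comp_def by blast
  define B where "B = (\<Inter>i. g (h (r (s i))))"
  have B: "B \<in> U" using s(2) by (simp add: B_def)
  have "i \<le> f B n" for i
  proof -
    have "B \<subseteq> g (h (r (s i)))" unfolding B_def by blast
    then have "h (r (s i)) n \<le> f B n" using g(2)[OF B] by (simp add: le_fun_def)
    moreover have "i \<le> r (s i)"
      using seq_suble[OF r(1), of "s i"] seq_suble[OF s(1), of i] by linarith
    ultimately show ?thesis using h(1)[of "r (s i)"] by linarith
  qed
  then show False using not_less_eq_eq by blast
qed


section \<open>The Fubini square is not of maximal type\<close>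

lemma uncountable_nat_bool: "uncountable (UNIV :: (nat \<Rightarrow> bool) set)"
proof
  assume "countable (UNIV :: (nat \<Rightarrow> bool) set)"
  then have "|UNIV :: (nat \<Rightarrow> bool) set| <o continuum" by (rule countable_ordLess_continuum)
  then show False using continuum_ordIso not_ordLess_ordIso ordIso_symmetric by blast
qed

text \<open>Otherwise every point lies in a countable fibre of some \<open>\<rho> k\<close>; there
  are only countably many such fibres, so the type would be countable.\<close>

lemma condensation_point:
  fixes \<rho> :: "nat \<Rightarrow> 'a \<Rightarrow> 'b"
  assumes "uncountable (UNIV :: 'a set)" "\<And>k. countable (range (\<rho> k))"
  shows "\<exists>a. \<forall>k. uncountable {b. \<rho> k b = \<rho> k a}"
proof (rule ccontr)
  assume "\<not> ?thesis"
  then have small: "\<exists>k. countable {b. \<rho> k b = \<rho> k a}" for a by simp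
  have "UNIV \<subseteq> (\<Union>k. \<Union>c\<in>{c \<in> range (\<rho> k). countable {b. \<rho> k b = c}}. {b. \<rho> k b = c})"
  proof
    fix a
    from small[of a] obtain k where "countable {b. \<rho> k b = \<rho> k a}" by (elim exE)
    then show "a \<in> (\<Union>k. \<Union>c\<in>{c \<in> range (\<rho> k). countable {b. \<rho> k b = c}}. {b. \<rho> k b = c})"
      by auto
  qed
  moreover have "countable (\<Union>k. \<Union>c\<in>{c \<in> range (\<rho> k). countable {b. \<rho> k b = c}}. {b. \<rho> k b = c})"
  proof (intro countable_UN)
    show "countable {c \<in> range (\<rho> k). countable {b. \<rho> k b = c}}" for k
      using assms(2) by (rule countable_subset[rotated]) blast
  qed auto
  ultimately show False using assms(1) countable_subset by blast
qed

text \<open>\<open>\<rho> k\<close> records a finite square of information, hence has countable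
  range. For a condensation point \<open>a\<close>, uncountably many points agree with
  \<open>a\<close> on each square, so each \<open>b k\<close> can avoid the earlier ones.\<close>

lemma convergent_injective_sequence:
  fixes \<phi> :: "'a \<Rightarrow> nat \<Rightarrow> nat set"
  assumes "uncountable (UNIV :: 'a set)"
  obtains a and b :: "nat \<Rightarrow> 'a" where "inj b" "\<And>i. converges (\<lambda>k. \<phi> (b k) i) (\<phi> a i)"
proof -
  define \<rho> where "\<rho> = (\<lambda>k a. {(i, x). i < k \<and> x < k \<and> x \<in> \<phi> a i})"
  have "range (\<rho> k) \<subseteq> Collect finite" for k
  proof clarify
    fix a
    have "\<rho> k a \<subseteq> {..<k} \<times> {..<k}" by (auto simp: \<rho>_def)
    then show "finite (\<rho> k a)" by (rule finite_subset) simp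
  qed
  then have "countable (range (\<rho> k))" for k
    using countable_Collect_finite countable_subset by blast
  then obtain a where a: "\<And>k. uncountable {b. \<rho> k b = \<rho> k a}"
    using condensation_point[OF assms] by metis
  \<comment> \<open>The second component is a finite set containing all points used so far.\<close>
  have "\<exists>p. \<forall>k. (finite (snd (p k)) \<and> \<rho> k (fst (p k)) = \<rho> k a \<and> fst (p k) \<in> snd (p k)) \<and>
    (fst (p (Suc k)) \<notin> snd (p k) \<and> snd (p k) \<subseteq> snd (p (Suc k)))"
  proof (rule dependent_nat_choice)
    show "\<exists>p. finite (snd p) \<and> \<rho> 0 (fst p) = \<rho> 0 a \<and> fst p \<in> snd p"
      by (rule exI[of _ "(a, {a})"]) simp
    fix p :: "'a \<times> 'a set" and k
    assume p: "finite (snd p) \<and> \<rho> k (fst p) = \<rho> k a \<and> fst p \<in> snd p"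
    have "\<not> {b. \<rho> (Suc k) b = \<rho> (Suc k) a} \<subseteq> snd p"
      using a[of "Suc k"] p countable_finite countable_subset by blast
    then obtain b where "\<rho> (Suc k) b = \<rho> (Suc k) a" "b \<notin> snd p" by blast
    then show "\<exists>q. (finite (snd q) \<and> \<rho> (Suc k) (fst q) = \<rho> (Suc k) a \<and> fst q \<in> snd q) \<and>
      (fst q \<notin> snd p \<and> snd p \<subseteq> snd q)"
      using p by (intro exI[of _ "(b, insert b (snd p))"]) auto
  qed
  then obtain p where p: "\<And>k. \<rho> k (fst (p k)) = \<rho> k a" "\<And>k. fst (p k) \<in> snd (p k)"
    "\<And>k. fst (p (Suc k)) \<notin> snd (p k)" "\<And>k. snd (p k) \<subseteq> snd (p (Suc k))"
    by blast
  have neq: "fst (p k) \<noteq> fst (p l)" if "k < l" for k l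
  proof -
    obtain l' where l': "l = Suc l'" "k \<le> l'" using \<open>k < l\<close> by (cases l) auto
    have "snd (p k) \<subseteq> snd (p l')" using lift_Suc_mono_le[of "\<lambda>k. snd (p k)", OF p(4) l'(2)] .
    then show ?thesis using p(2)[of k] p(3)[of l'] l'(1) by auto
  qed
  show ?thesis
  proof
    show "inj (\<lambda>k. fst (p k))"
      by (rule injI) (metis neq linorder_neqE_nat)
    show "converges (\<lambda>k. \<phi> (fst (p k)) i) (\<phi> a i)" for i
      unfolding converges_def eventually_sequentially
    proof (intro allI exI impI)
      fix x k assume "Suc (max i x) \<le> k"
      then show "x \<in> \<phi> (fst (p k)) i \<longleftrightarrow> x \<in> \<phi> a i"
        using arg_cong[OF p(1)[of k], of "\<lambda>r. (i, x) \<in> r"]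
        by (auto simp: \<rho>_def Suc_le_eq)
    qed
  qed
qed

lemma p_point_bounded_subseq_countable:
  fixes A :: "nat \<Rightarrow> nat \<Rightarrow> nat set"
  assumes U: "p_point U" and A: "\<And>k i. A k i \<in> U" "\<And>i. converges (\<lambda>k. A k i) (B i)" "\<And>i. B i \<in> U"
  obtains d :: "nat \<Rightarrow> nat" where "strict_mono d" "\<And>i. (\<Inter>k. A (d k) i) \<in> U"
proof -
  have ultra: "ultrafilter U" using U by (simp add: p_point_def)
  interpret subseqs "\<lambda>n s. (\<Inter>k. A (s k) n) \<in> U"
  proof
    fix n and s :: "nat \<Rightarrow> nat" assume "strict_mono s"
    then have "converges (\<lambda>k. A (s k) n) (B n)"
      using converges_compose[OF A(2)] unfolding comp_def by blast
    then obtain r :: "nat \<Rightarrow> nat" where "strict_mono r" "(\<Inter>k. A (s (r k)) n) \<in> U"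
      by (rule p_point_bounded_subseq[of U "\<lambda>k. A (s k) n", OF U A(1) _ A(3)]) (rule that)
    then show "\<exists>r :: nat \<Rightarrow> nat. strict_mono r \<and> (\<Inter>k. A ((s \<circ> r) k) n) \<in> U" by auto
  qed
  have "(\<Inter>k. A (diagseq k) n) \<in> U" for n
  proof -
    have "(\<Inter>k. A ((diagseq \<circ> (+) (Suc n)) k) n) \<in> U"
    proof (rule diagseq_holds)
      fix r s m assume "(\<Inter>k. A (s k) m) \<in> U"
      then show "(\<Inter>k. A ((s \<circ> r) k) m) \<in> U"
        by (rule ultrafilter_superset[OF ultra]) auto
    qed
    \<comment> \<open>The tail from \<open>Suc n\<close> on is a subsequence of the one treating
      coordinate \<open>n\<close>; the terms up to \<open>n\<close> are finitely many members of
      \<open>U\<close>.\<close>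
    then have "(\<Inter>k. A (diagseq (Suc n + k)) n) \<inter> (\<Inter>k\<in>{..n}. A (diagseq k) n) \<in> U"
      using ultrafilter_finite_INT[OF ultra, of "{..n}" "\<lambda>k. A (diagseq k) n"] A(1)
      by (intro ultrafilter_Int[OF ultra]) simp_all
    moreover have "(\<Inter>k. A (diagseq (Suc n + k)) n) \<inter> (\<Inter>k\<in>{..n}. A (diagseq k) n) \<subseteq> (\<Inter>k. A (diagseq k) n)"
    proof (rule subsetI, rule INT_I)
      fix x k assume x: "x \<in> (\<Inter>k. A (diagseq (Suc n + k)) n) \<inter> (\<Inter>k\<in>{..n}. A (diagseq k) n)"
      show "x \<in> A (diagseq k) n"
      proof (cases "k \<le> n")
        case False
        then show ?thesis using INT_D[OF IntD1[OF x] UNIV_I, of "k - Suc n"] by simp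
      qed (use x in auto)
    qed
    ultimately show ?thesis by (rule ultrafilter_superset[OF ultra])
  qed
  then show ?thesis using that subseq_diagseq by blast
qed

text \<open>A reduction gives sets \<open>g x\<close> such that members of the square inside
  \<open>g x\<close> are mapped to finite sets containing \<open>x\<close>. This fails once
  infinitely many \<open>g x\<close> have a common subset \<open>B\<close> in the square.\<close>

lemma top_not_tukey_le_fubini_square:
  assumes U: "p_point U"
  shows "\<not> finite_subsets_order continuum \<le>\<^sub>T reverse_inclusion (fubini_square U)"
proof
  have ultra: "ultrafilter U" using U by (simp add: p_point_def)
  assume "finite_subsets_order continuum \<le>\<^sub>T reverse_inclusion (fubini_square U)"
  then obtain f :: "(nat \<times> nat) set \<Rightarrow> (nat \<Rightarrow> bool) set"
    where f: "f ` Field (reverse_inclusion (fubini_square U)) \<subseteq> Field (finite_subsets_order continuum)"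
      and f': "\<And>F. F \<in> Field (finite_subsets_order continuum) \<Longrightarrow>
        \<exists>A\<in>Field (reverse_inclusion (fubini_square U)). \<forall>B. (A, B) \<in> reverse_inclusion (fubini_square U) \<longrightarrow>
          (F, f B) \<in> finite_subsets_order continuum"
    by (rule tukey_leE) (rule that)
  have "\<exists>A\<in>fubini_square U. \<forall>B\<in>fubini_square U. B \<subseteq> A \<longrightarrow> x \<in> f B" for x
  proof -
    have "{x} \<in> Field (finite_subsets_order continuum)"
      by (simp add: Field_directed_sets Field_continuum Fpow_def)
    from f'[OF this] obtain A where A: "A \<in> Field (reverse_inclusion (fubini_square U))"
      and AB: "\<forall>B. (A, B) \<in> reverse_inclusion (fubini_square U) \<longrightarrow>
        ({x}, f B) \<in> finite_subsets_order continuum"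
      by (elim bexE)
    have "x \<in> f B" if "B \<in> fubini_square U" "B \<subseteq> A" for B
      using AB[rule_format, of B] A that
      by (simp add: Field_directed_sets in_reverse_inclusion in_finite_subsets_order)
    then show ?thesis using A by (auto simp: Field_directed_sets)
  qed
  then obtain g where g: "\<And>x. g x \<in> fubini_square U"
    "\<And>x B. B \<in> fubini_square U \<Longrightarrow> B \<subseteq> g x \<Longrightarrow> x \<in> f B" by metis
  \<comment> \<open>Coordinate 0 holds the indices of large slices, the others the slices. The
    default \<open>UNIV\<close> keeps all coordinates in \<open>U\<close> and is harmless, since
    \<open>B\<close> uses only indices from \<open>W 0\<close>.\<close>
  define \<phi> where "\<phi> = (\<lambda>x k. case k of 0 \<Rightarrow> {i. slice (g x) i \<in> U}
    | Suc i \<Rightarrow> if slice (g x) i \<in> U then slice (g x) i else UNIV)"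
  have \<phi>: "\<phi> x k \<in> U" for x k
    using g(1)[of x] ultrafilter_UNIV[OF ultra] by (simp add: \<phi>_def fubini_square_def split: nat.split)
  obtain a b where b: "inj b" "\<And>i. converges (\<lambda>k. \<phi> (b k) i) (\<phi> a i)"
    by (rule convergent_injective_sequence[OF uncountable_nat_bool, of \<phi>]) (rule that)
  obtain d :: "nat \<Rightarrow> nat" where d: "strict_mono d" "\<And>i. (\<Inter>k. \<phi> (b (d k)) i) \<in> U"
    by (rule p_point_bounded_subseq_countable[of U "\<lambda>k. \<phi> (b k)" "\<phi> a", OF U \<phi> b(2) \<phi>])
      (rule that)
  define W where "W = (\<lambda>i. \<Inter>k. \<phi> (b (d k)) i)"
  define B where "B = {(i, j). i \<in> W 0 \<and> j \<in> W (Suc i)}"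
  have W: "W i \<in> U" for i using d(2) by (simp add: W_def)
  have "slice B i = W (Suc i)" if "i \<in> W 0" for i using that by (auto simp: B_def)
  then have "W 0 \<subseteq> {i. slice B i \<in> U}" using W by auto
  then have B: "B \<in> fubini_square U"
    using ultrafilter_superset[OF ultra W] unfolding fubini_square_def by simp
  have "b (d k) \<in> f B" for k
  proof (rule g(2)[OF B], clarify)
    fix i j assume "(i, j) \<in> B"
    then have "i \<in> \<phi> (b (d k)) 0" "j \<in> \<phi> (b (d k)) (Suc i)" by (auto simp: B_def W_def)
    then show "(i, j) \<in> g (b (d k))" by (simp add: \<phi>_def)
  qed
  then have "range (b \<circ> d) \<subseteq> f B" by auto
  moreover have "finite (f B)" using f B by (auto simp: Field_directed_sets Fpow_def)
  moreover have "inj (b \<circ> d)" using b(1) strict_mono_imp_inj_on[OF d(1)] by (simp add: inj_compose)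
  ultimately show False using finite_subset range_inj_infinite by blast
qed

theorem theorem38:
  assumes "pseudo_intersection_number =o continuum"
  shows "\<exists>U. p_point U \<and>
    \<not> baire_order \<le>\<^sub>T reverse_inclusion U \<and>
    reverse_inclusion U <\<^sub>T reverse_inclusion (fubini_square U) \<and>
    reverse_inclusion (fubini_square U) <\<^sub>T finite_subsets_order continuum"
proof -
  obtain U where U: "p_point U"
    and escape: "\<And>g :: (nat \<Rightarrow> nat) \<Rightarrow> nat set. range g \<subseteq> U \<Longrightarrow>
      \<exists>n. \<exists>P\<in>U. \<forall>j t. finite t \<longrightarrow> t \<subseteq> P \<longrightarrow> (\<exists>h. j \<le> h n \<and> t \<subseteq> g h)"
    by (rule p_point_exists[OF assms]) (rule that)
  then have ultra: "ultrafilter U" "\<not> principal U" by (simp_all add: p_point_def)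
  have baire: "\<not> baire_order \<le>\<^sub>T reverse_inclusion U"
    by (rule not_baire_tukey_le[OF U escape])
  then have "\<not> reverse_inclusion (fubini_square U) \<le>\<^sub>T reverse_inclusion U"
    using tukey_le_trans[OF baire_tukey_le_fubini_square[OF ultra]] by blast
  then show ?thesis
    using U baire ultrafilter_tukey_le_fubini_square[OF ultra(1)]
      fubini_square_tukey_le_top[OF ultra(1)] top_not_tukey_le_fubini_square[OF U]
    unfolding tukey_less_def by blast
qed

end
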